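(* For every convex $d$-polytope $P$ with $d>0$ and every generic sweep direction $p$, \[h(\partial P^* )=\sum_{v\in\mathrm{vert}(P)}\tfrac12\left[h(\partial(Q_v)^* )\,\mathbf{c}+h(\partial(R_v)^* )\,(2\mathbf{d}-\mathbf{c}^2)\right],\] where $\mathbf{c},\mathbf{d}$ act as operators on the right, $y(2\mathbf{d}-\mathbf{c}^2)$ means $2(y\mathbf{d})-((y\mathbf{c})\mathbf{c})$, and the second term is the zero vector when $R_v=\emptyset$. (For $d=0$, $h(\partial P^* )=(1)$.)
   Context: Toric $h$-vector: for a $d$-polytope $X$, $h(\partial X,x)=\sum_{i=0}^dh_ix^{d-i}$, $g(\partial X,x)=\sum_{i=0}^{\lfloor d/2\rfloor}g_ix^i$ with $g_0=h_0$, $g_i=h_i-h_{i-1}$; recursively $g(\partial G,x)=1$ for the empty face $G$ and $h(\partial X,x)=\sum_G g(\partial G,x)(x-1)^{d-1-\dim G}$ over all faces $G$ of the boundary complex $\partial X$ (including $\emptyset$, $\dim\emptyset=-1$); $h(\partial X)=(h_0,\dots,h_d)$. $X^*$ denotes a dual polytope. Operators on $(h_0,\dots,h_d)$ with $g_0=h_0$, $g_i=h_i-h_{i-1}$ ($1\le i\le\lfloor d/2\rfloor$): $(h_0,\dots,h_d)\mathbf{c}=(g_0,\dots,g_{\lfloor d/2\rfloor},g_{\lfloor d/2\rfloor},\dots,g_0)$ for $d$ even, $(g_0,\dots,g_{\lfloor d/2\rfloor},0,g_{\lfloor d/2\rfloor},\dots,g_0)$ for $d$ odd; $(h_0,\dots,h_d)\mathbf{d}$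 is the length-$(d+3)$ vector with $g_{\lfloor d/2\rfloor}$ in the middle and zeros elsewhere for $d$ even, and zero for $d$ odd. Sweeping: $p\in\mathbb{R}^d$ with $p\cdot x$ distinct on vertices of $P$ and polytopes below. For a vertex $v$: $Q_v$ is the vertex figure, the $(d-1)$-polytope cut from $P$ by a translate, a sufficiently small depth into $P$, of a supporting hyperplane meeting $P$ only in $v$; $H_v=\{p\cdot x=p\cdot v\}$; $R_v=Q_v\cap H_v$ (empty iff $v$ minimizes or maximizes $p\cdot x$ on $P$, else a $(d-2)$-polytope). *)

theory Defs
  imports "HOL-Analysis.Analysis" "HOL-Computational_Algebra.Polynomial"
begin

text \<open>
  A vector $(h_0,\dots,h_d)$ is a list of length \<open>d + 1\<close>; the operators below read \<open>d\<close>
  off the length of their argument.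
\<close>

definition g_vec :: "real list \<Rightarrow> real list" where
  "g_vec h = map (\<lambda>i. if i = 0 then h ! 0 else h ! i - h ! (i - 1))
     [0..<Suc ((length h - 1) div 2)]"

definition op_c :: "real list \<Rightarrow> real list" where
  "op_c h = g_vec h @ (if even (length h - 1) then [] else [0]) @ rev (g_vec h)"

definition op_d :: "real list \<Rightarrow> real list" where
  "op_d h = (let d = length h - 1 in
     if even d
     then replicate (d div 2 + 1) 0 @ [g_vec h ! (d div 2)] @ replicate (d div 2 + 1) 0
     else replicate (d + 3) 0)"

text \<open>The coefficients $h_0,\dots,h_d$ are numbered from the top: $\sum_i h_i x^{d-i}$.\<close>

definition coeffs_from_top :: "nat \<Rightarrow> real poly \<Rightarrow> real list" where
  "coeffs_from_top d q = map (\<lambda>i. coeff q (d - i)) [0..<Suc d]"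

text \<open>
  \<open>toric_h X\<close> and \<open>toric_g X\<close> are $h(\partial X, x)$ and $g(\partial X, x)$. The faces of the
  boundary complex are the faces of \<open>X\<close> other than \<open>X\<close>, with the empty face included;
  \<open>aff_dim {} = - 1\<close>. The value \<open>0\<close> on sets that are not polytopes merely serves to make the
  recursion terminate.
\<close>

function toric_h :: "'a::euclidean_space set \<Rightarrow> real poly"
  and toric_g :: "'a::euclidean_space set \<Rightarrow> real poly" where
  "toric_h X = (if polytope X
     then (\<Sum>G\<in>{G. G face_of X \<and> G \<noteq> X}.
             toric_g G * [:-1, 1:] ^ nat (aff_dim X - 1 - aff_dim G))
     else 0)"
| "toric_g X = (if X = {} then 1
     else Poly (g_vec (coeffs_from_top (nat (aff_dim X)) (toric_h X))))"
  by pat_completeness auto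
termination
proof (relation "Wellfounded.measure (\<lambda>s. case s of
    Inl X \<Rightarrow> 2 * nat (aff_dim X + 1) | Inr X \<Rightarrow> 2 * nat (aff_dim X + 1) + 1)", goal_cases)
  case (2 X G)
  then have "aff_dim G < aff_dim X"
    by (auto intro: face_of_aff_dim_lt polytope_imp_convex)
  then show ?case
    using aff_dim_geq[of G] by simp
qed auto

declare toric_h.simps [simp del] toric_g.simps [simp del]

definition h_vector :: "'a::euclidean_space set \<Rightarrow> real list" where
  "h_vector X = coeffs_from_top (nat (aff_dim X)) (toric_h X)"

text \<open>\<open>Y\<close> is a dual polytope of \<open>X\<close>: their face lattices are anti-isomorphic.\<close>

definition dual_polytope :: "'a::euclidean_space set \<Rightarrow> 'a set \<Rightarrow> bool" where
  "dual_polytope X Y \<longleftrightarrow> polytope X \<and> polytope Y \<and>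
     (\<exists>\<phi>. bij_betw \<phi> {F. F face_of X} {G. G face_of Y} \<and>
          (\<forall>F F'. F face_of X \<longrightarrow> F' face_of X \<longrightarrow> (F \<subseteq> F' \<longleftrightarrow> \<phi> F' \<subseteq> \<phi> F)))"

definition vertices :: "'a::euclidean_space set \<Rightarrow> 'a set" where
  "vertices P = {v. v extreme_point_of P}"

text \<open>
  The hyperplane \<open>a \<bullet> x = b\<close> supports \<open>P\<close> exactly in \<open>v\<close>, and \<open>a \<bullet> x = c\<close> is its translate
  into \<open>P\<close>. The depth \<open>b - c\<close> is sufficiently small when the translate strictly separates
  \<open>v\<close> from all other vertices.
\<close>

definition vertex_figure :: "'a::euclidean_space set \<Rightarrow> 'a \<Rightarrow> 'a set \<Rightarrow> bool" where
  "vertex_figure P v Q \<longleftrightarrow> (\<exists>a b c. a \<noteq> 0 \<and>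
     (\<forall>x\<in>P. a \<bullet> x \<le> b) \<and> P \<inter> {x. a \<bullet> x = b} = {v} \<and>
     c < b \<and> (\<forall>w\<in>vertices P. w \<noteq> v \<longrightarrow> a \<bullet> w < c) \<and>
     Q = P \<inter> {x. a \<bullet> x = c})"

definition generic_sweep :: "'a::euclidean_space set \<Rightarrow> 'a \<Rightarrow> bool" where
  "generic_sweep P p \<longleftrightarrow> inj_on (\<lambda>v. p \<bullet> v) (vertices P)"

definition sweep_section :: "'a::euclidean_space \<Rightarrow> 'a \<Rightarrow> 'a set \<Rightarrow> 'a set" where
  "sweep_section p v Q = Q \<inter> {x. p \<bullet> x = p \<bullet> v}"

end

theory Submission
  imports Defs
begin

text \<open>
  Every nonempty face of \<open>P\<close> has exactly one vertex where the sweep is minimal and exactly one where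
  it is maximal. Counting faces by both, the faces through \<open>v\<close> that are counted at \<open>v\<close> are $\{v\}$, twice,
  and those whose trace on the vertex figure misses the sweep hyperplane $H_v$; the remaining ones
  correspond to the nonempty faces of $R_v$. Summing $g(\partial (P/F)^*, x) (x-1)^{\dim F}$ gives
  \[ 2 h(\partial P^*, x) = \sum_v \bigl[ 2 g(\partial Q_v^*, x) + (x-1) h(\partial Q_v^*, x)
     - (x-1)^2 h(\partial R_v^*, x) \bigr]. \]
  By induction on the dimension this identity makes $h(\partial P^*, x)$ palindromic, and on palindromic
  polynomials the first two summands are the operator \<open>op_c\<close>, while $-(x-1)^2$ is
  twice \<open>op_d\<close> minus the square of \<open>op_c\<close>.
\<close>

section \<open>Hyperplane sections and face lattices\<close>

text \<open>The given dual polytopes are related to \<open>P\<close> only through their face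
  lattices, so everything is moved to upper intervals of the face lattice of \<open>P\<close>. A
  hyperplane through no vertex of a polytope preserves the interval above each face that it cuts and
  lowers all dimensions there by one. Q_v is such a section of \<open>P\<close>, and genericity
  makes R_v such a section of Q_v. Hence one family of polynomials g, indexed by the faces of
  \<open>P\<close>, yields all three h-polynomials; the factors x - 1 and (x - 1)^2 undo one and two
  cuts. The operators read only half of a vector, while the sweep identity contains full
  h-polynomials. For palindromic q of degree at most n, (1 - x) q is antisymmetric with lower half
  g, so 2 g + (x - 1) q is g plus its mirror image, which is qc. In the same terms qd = g(qc) + (x -
  1) g(q), and expanding c twice gives qcc = 2 qd + (x - 1)^2 q.\<close>

lemma polytope_eq_hull_vertices:
  "polytope P \<Longrightarrow> P = convex hull (vertices P)"
  unfolding vertices_def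
  by (simp add: Krein_Milman_Minkowski polytope_imp_compact polytope_imp_convex)

lemma finite_vertices: "polytope P \<Longrightarrow> finite (vertices P)"
  unfolding vertices_def
  by (simp add: finite_polyhedron_extreme_points polytope_imp_polyhedron)

lemma vertices_nonempty: "polytope P \<Longrightarrow> P \<noteq> {} \<Longrightarrow> vertices P \<noteq> {}"
  using polytope_eq_hull_vertices by fastforce

lemma vertices_subset: "vertices P \<subseteq> P"
  by (auto simp: vertices_def extreme_point_of_def)

lemma vertices_face: "F face_of P \<Longrightarrow> vertices F = vertices P \<inter> F"
  by (auto simp: vertices_def extreme_point_of_face)

lemma vertex_face: "v \<in> vertices P \<longleftrightarrow> {v} face_of P"
  by (simp add: vertices_def face_of_singleton)

lemma vertices_singleton: "vertices {v} = {v}"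
  by (auto simp: vertices_def)

lemma polytope_eq_singleton_iff:
  assumes "polytope F"
  shows "F = {v} \<longleftrightarrow> vertices F = {v}"
  using polytope_eq_hull_vertices[OF assms] by (metis convex_hull_singleton vertices_singleton)

lemma segment_meets_hyperplane:
  fixes a y w :: "'a::euclidean_space"
  assumes "a \<bullet> y < c" "c < a \<bullet> w"
  obtains t where "0 < t" "t < 1" "a \<bullet> ((1 - t) *\<^sub>R y + t *\<^sub>R w) = c"
proof
  define t where "t = (c - a \<bullet> y) / (a \<bullet> w - a \<bullet> y)"
  show "0 < (c - a \<bullet> y) / (a \<bullet> w - a \<bullet> y)" "(c - a \<bullet> y) / (a \<bullet> w - a \<bullet> y) < 1"
    using assms by auto
  have "t * (a \<bullet> w - a \<bullet> y) = c - a \<bullet> y"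
    unfolding t_def using assms by simp
  then show "a \<bullet> ((1 - (c - a \<bullet> y) / (a \<bullet> w - a \<bullet> y)) *\<^sub>R y + ((c - a \<bullet> y) / (a \<bullet> w - a \<bullet> y)) *\<^sub>R w) = c"
    unfolding t_def[symmetric] by (simp add: inner_add_right algebra_simps)
qed

lemma rel_interior_meets_hyperplane_aux:
  fixes F :: "'a::euclidean_space set"
  assumes "convex F" "y \<in> rel_interior F" "w \<in> F" "a \<bullet> y < c" "c < a \<bullet> w"
  shows "rel_interior F \<inter> {x. a \<bullet> x = c} \<noteq> {}"
proof -
  obtain t where t: "0 < t" "t < 1" "a \<bullet> ((1 - t) *\<^sub>R y + t *\<^sub>R w) = c"
    using segment_meets_hyperplane assms(4,5) by blast
  have "(1 - t) *\<^sub>R y + t *\<^sub>R w \<in> open_segment y w"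
    using t assms by (auto simp: in_segment)
  moreover have "open_segment y w \<subseteq> rel_interior F"
    using assms closure_subset by (intro rel_interior_closure_convex_segment) auto
  ultimately show ?thesis using t by blast
qed

text \<open>If all vertices lay strictly on one side, so would their hull \<open>F\<close>. This
  turns incidence with a hyperplane into a condition on vertices.\<close>

lemma hyperplane_separates_vertices:
  fixes F :: "'a::euclidean_space set"
  assumes "polytope F" "\<And>w. w \<in> vertices F \<Longrightarrow> a \<bullet> w \<noteq> c" "F \<inter> {x. a \<bullet> x = c} \<noteq> {}"
  obtains w1 w2 where "w1 \<in> vertices F" "w2 \<in> vertices F" "a \<bullet> w1 < c" "c < a \<bullet> w2"
proof -
  have F: "F = convex hull (vertices F)" by (rule polytope_eq_hull_vertices[OF assms(1)])
  have "\<exists>w\<in>vertices F. a \<bullet> w < c"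
  proof (rule ccontr)
    assume "\<not> ?thesis"
    then have "vertices F \<subseteq> {x. a \<bullet> x > c}" using assms(2) by force
    then have "F \<subseteq> {x. a \<bullet> x > c}"
      using F by (metis convex_halfspace_gt hull_minimal)
    then show False using assms(3) by force
  qed
  moreover have "\<exists>w\<in>vertices F. c < a \<bullet> w"
  proof (rule ccontr)
    assume "\<not> ?thesis"
    then have "vertices F \<subseteq> {x. a \<bullet> x < c}" using assms(2) by force
    then have "F \<subseteq> {x. a \<bullet> x < c}"
      using F by (metis convex_halfspace_lt hull_minimal)
    then show False using assms(3) by force
  qed
  ultimately show ?thesis using that by blast
qed

text \<open>Start at a relative interior point and move towards a vertex on the other side: the open
  segment stays in the relative interior and crosses the hyperplane.\<close>

lemma rel_interior_meets_hyperplane: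
  fixes F :: "'a::euclidean_space set"
  assumes "polytope F" "\<And>w. w \<in> vertices F \<Longrightarrow> a \<bullet> w \<noteq> c" "F \<inter> {x. a \<bullet> x = c} \<noteq> {}"
  shows "rel_interior F \<inter> {x. a \<bullet> x = c} \<noteq> {}"
proof -
  obtain w1 w2 where w: "w1 \<in> F" "w2 \<in> F" "a \<bullet> w1 < c" "c < a \<bullet> w2"
    using hyperplane_separates_vertices[OF assms] vertices_subset by (metis subsetD)
  have cv: "convex F" using assms(1) by (rule polytope_imp_convex)
  obtain y where y: "y \<in> rel_interior F"
    using w cv rel_interior_eq_empty by blast
  consider "a \<bullet> y = c" | "a \<bullet> y < c" | "a \<bullet> y > c" by linarith
  then show ?thesis
  proof cases
    case 1 then show ?thesis using y by blast
  next
    case 2 then show ?thesis using rel_interior_meets_hyperplane_aux[OF cv y] w by blast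
  next
    case 3
    then have "rel_interior F \<inter> {x. (- a) \<bullet> x = - c} \<noteq> {}"
      using w by (intro rel_interior_meets_hyperplane_aux[OF cv y w(1)]) auto
    then show ?thesis by auto
  qed
qed

text \<open>Around a relative interior point on the hyperplane, \<open>F\<close> coincides with its
  affine hull. So the section spans the hyperplane section of that hull, and this is proper because
  the vertices avoid the hyperplane.\<close>

lemma aff_dim_hyperplane_section:
  fixes F :: "'a::euclidean_space set"
  assumes "polytope F" "\<And>w. w \<in> vertices F \<Longrightarrow> a \<bullet> w \<noteq> c" "F \<inter> {x. a \<bullet> x = c} \<noteq> {}"
  shows "aff_dim (F \<inter> {x. a \<bullet> x = c}) = aff_dim F - 1"
proof -
  let ?H = "{x. a \<bullet> x = c}"
  obtain x where x: "x \<in> rel_interior F" "x \<in> ?H"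
    using rel_interior_meets_hyperplane[OF assms] by blast
  obtain T where T: "open T" "x \<in> T" "T \<inter> affine hull F \<subseteq> F"
    using x(1) by (auto simp: mem_rel_interior)
  have xF: "x \<in> affine hull F" using x(1) rel_interior_subset[of F] by (auto intro: hull_inc)
  have "affine hull ((affine hull F \<inter> ?H) \<inter> T) = affine hull (affine hull F \<inter> ?H)"
    using T x xF
    by (intro affine_hull_affine_Int_open affine_Int affine_affine_hull affine_hyperplane) auto
  moreover have "affine hull F \<inter> ?H \<inter> T \<subseteq> F \<inter> ?H" using T by auto
  moreover have "F \<inter> ?H \<subseteq> affine hull F \<inter> ?H" using hull_subset[of F affine] by blast
  ultimately have "affine hull (F \<inter> ?H) = affine hull (affine hull F \<inter> ?H)"
    using hull_mono[of "affine hull F \<inter> ?H \<inter> T" "F \<inter> ?H" affine]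
      hull_mono[of "F \<inter> ?H" "affine hull F \<inter> ?H" affine] by simp
  then have "aff_dim (F \<inter> ?H) = aff_dim (affine hull F \<inter> ?H)"
    by (metis aff_dim_affine_hull)
  moreover have "\<not> affine hull F \<subseteq> ?H"
  proof -
    obtain w where "w \<in> vertices F"
      using vertices_nonempty[OF assms(1)] assms(3) by blast
    then show ?thesis
      using assms(2) vertices_subset[of F] hull_subset[of F affine] by blast
  qed
  ultimately show ?thesis
    using x xF aff_dim_affine_Int_hyperplane[OF affine_affine_hull, of F a c]
    by auto
qed

text \<open>The inclusion-minimal face through \<open>x\<close> works: a point of its relative
  frontier would lie in a smaller face.\<close>

lemma rel_interior_face_exists:
  fixes P :: "'a::euclidean_space set"
  assumes "polytope P" "x \<in> P"
  obtains F where "F face_of P" "x \<in> rel_interior F"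
proof -
  let ?A = "{F. F face_of P \<and> x \<in> F}"
  have fin: "finite ?A" using finite_polytope_faces[OF assms(1)] by (rule rev_finite_subset) auto
  have "P \<in> ?A" using assms by (simp add: face_of_refl polytope_imp_convex)
  then have ne: "?A \<noteq> {}" by blast
  obtain F where F: "F \<in> ?A" "\<And>G. G \<in> ?A \<Longrightarrow> G \<subseteq> F \<Longrightarrow> F = G"
    using finite_has_minimal[OF fin ne] by (metis)
  have "polyhedron F"
    using F assms(1) face_of_polytope_polytope polytope_imp_polyhedron by blast
  have "x \<notin> rel_frontier F"
  proof
    assume "x \<in> rel_frontier F"
    then obtain G where "G face_of F" "G \<noteq> F" "x \<in> G"
      using rel_frontier_of_polyhedron_alt[OF \<open>polyhedron F\<close>] by blast
    then show False using F face_of_trans face_of_imp_subset by blast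
  qed
  then have "x \<in> rel_interior F"
    using F \<open>polyhedron F\<close> closure_subset by (auto simp: rel_frontier_def)
  then show ?thesis using that F by blast
qed

lemma vertices_face_avoid:
  "F face_of P \<Longrightarrow> (\<And>w. w \<in> vertices P \<Longrightarrow> a \<bullet> w \<noteq> c) \<Longrightarrow> w \<in> vertices F \<Longrightarrow> a \<bullet> w \<noteq> c"
  by (simp add: vertices_face)

lemma polytope_hyperplane_section:
  fixes P :: "'a::euclidean_space set"
  shows "polytope P \<Longrightarrow> polytope (P \<inter> {x. a \<bullet> x = c})"
  by (simp add: polytope_Int_polyhedron polyhedron_hyperplane)

lemma rel_interior_section:
  fixes P :: "'a::euclidean_space set"
  assumes "polytope P" "\<And>w. w \<in> vertices P \<Longrightarrow> a \<bullet> w \<noteq> c" "F face_of P"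
    "F \<inter> {x. a \<bullet> x = c} \<noteq> {}"
  shows "rel_interior F \<inter> {x. a \<bullet> x = c} \<noteq> {}"
    "rel_interior (F \<inter> {x. a \<bullet> x = c}) = rel_interior F \<inter> {x. a \<bullet> x = c}"
proof -
  have pF: "polytope F" using assms face_of_polytope_polytope by blast
  show *: "rel_interior F \<inter> {x. a \<bullet> x = c} \<noteq> {}"
    using assms(4) vertices_face_avoid[OF assms(3,2)]
    by (intro rel_interior_meets_hyperplane[OF pF]) auto
  show "rel_interior (F \<inter> {x. a \<bullet> x = c}) = rel_interior F \<inter> {x. a \<bullet> x = c}"
    by (intro convex_affine_rel_interior_Int polytope_imp_convex[OF pF] affine_hyperplane *)
qed

text \<open>A face that meets the hyperplane does so in its relative interior, and a face
  \<open>G\<close> containing one relative interior point of \<open>F\<close> contains all of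
  \<open>F\<close>.\<close>

lemma section_faces_order:
  fixes P :: "'a::euclidean_space set"
  assumes "polytope P" "\<And>w. w \<in> vertices P \<Longrightarrow> a \<bullet> w \<noteq> c"
    "F face_of P" "F \<inter> {x. a \<bullet> x = c} \<noteq> {}" "G face_of P"
  shows "F \<inter> {x. a \<bullet> x = c} \<subseteq> G \<inter> {x. a \<bullet> x = c} \<longleftrightarrow> F \<subseteq> G"
proof
  assume *: "F \<inter> {x. a \<bullet> x = c} \<subseteq> G \<inter> {x. a \<bullet> x = c}"
  obtain x where "x \<in> rel_interior F" "a \<bullet> x = c"
    using rel_interior_section(1)[OF assms(1-4)] by blast
  then have "x \<in> G \<inter> rel_interior F"
    using * rel_interior_subset by blast
  then show "F \<subseteq> G"
    using subset_of_face_of[OF assms(5) face_of_imp_subset[OF assms(3)]] by blast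
qed auto

text \<open>Injectivity is \<open>section_faces_order\<close>. For surjectivity, a relative interior
  point of a face \<open>K\<close> of the section picks out a face \<open>F\<close> of
  \<open>P\<close>; the trace of \<open>F\<close> shares that relative interior point with
  \<open>K\<close>, so the two coincide.\<close>

lemma section_faces_bij:
  fixes P :: "'a::euclidean_space set"
  assumes "polytope P" "\<And>w. w \<in> vertices P \<Longrightarrow> a \<bullet> w \<noteq> c"
  shows "bij_betw (\<lambda>F. F \<inter> {x. a \<bullet> x = c}) {F. F face_of P \<and> F \<inter> {x. a \<bullet> x = c} \<noteq> {}}
    {K. K face_of (P \<inter> {x. a \<bullet> x = c}) \<and> K \<noteq> {}}"
proof (rule bij_betw_imageI)
  let ?H = "{x. a \<bullet> x = c}"
  show "inj_on (\<lambda>F. F \<inter> ?H) {F. F face_of P \<and> F \<inter> ?H \<noteq> {}}"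
  proof (rule inj_onI)
    fix F G
    assume "F \<in> {F. F face_of P \<and> F \<inter> ?H \<noteq> {}}" "G \<in> {F. F face_of P \<and> F \<inter> ?H \<noteq> {}}"
      and eq: "F \<inter> ?H = G \<inter> ?H"
    then have F: "F face_of P" "F \<inter> ?H \<noteq> {}" and G: "G face_of P" "G \<inter> ?H \<noteq> {}" by blast+
    show "F = G"
    proof (rule equalityI)
      show "F \<subseteq> G" using section_faces_order[OF assms F G(1)] eq by blast
      show "G \<subseteq> F" using section_faces_order[OF assms G F(1)] eq by blast
    qed
  qed
  show "(\<lambda>F. F \<inter> ?H) ` {F. F face_of P \<and> F \<inter> ?H \<noteq> {}} = {K. K face_of (P \<inter> ?H) \<and> K \<noteq> {}}"
    (is "?L = ?R")
  proof
    show "?L \<subseteq> ?R"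
      using face_of_slice[OF _ convex_hyperplane] by blast
    show "?R \<subseteq> ?L"
    proof
      fix K assume "K \<in> ?R"
      then have K: "K face_of (P \<inter> ?H)" "K \<noteq> {}" by auto
      then obtain x where x: "x \<in> rel_interior K"
        using face_of_imp_convex rel_interior_eq_empty by blast
      then have xP: "x \<in> P" "x \<in> ?H"
        using K(1) face_of_imp_subset rel_interior_subset by blast+
      obtain F where F: "F face_of P" "x \<in> rel_interior F"
        using rel_interior_face_exists[OF assms(1) xP(1)] by blast
      have ne: "F \<inter> ?H \<noteq> {}" using F(2) xP(2) rel_interior_subset by blast
      have "(F \<inter> ?H) face_of (P \<inter> ?H)" using F(1) by (intro face_of_slice convex_hyperplane)
      moreover have "x \<in> rel_interior (F \<inter> ?H)"
        using rel_interior_section(2)[OF assms F(1) ne] F(2) xP(2) by blast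
      ultimately have "K = F \<inter> ?H" using K(1) x by (intro face_of_eq[of K "P \<inter> ?H"]) auto
      then show "K \<in> ?L" using F(1) ne by blast
    qed
  qed
qed

lemma aff_dim_section_face:
  fixes P :: "'a::euclidean_space set"
  assumes "polytope P" "\<And>w. w \<in> vertices P \<Longrightarrow> a \<bullet> w \<noteq> c" "F face_of P"
    "F \<inter> {x. a \<bullet> x = c} \<noteq> {}"
  shows "aff_dim (F \<inter> {x. a \<bullet> x = c}) = aff_dim F - 1"
  using assms(1,3,4) vertices_face_avoid[OF assms(3,2)] 
  by (intro aff_dim_hyperplane_section face_of_polytope_polytope[OF assms(1,3)]) auto

section \<open>Dimension as an invariant of the face lattice\<close>

text \<open>A nonempty \<open>F\<close> lies in a facet of \<open>G\<close>, which must be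
  \<open>F\<close> itself; above the empty face a vertex of \<open>G\<close> takes the place of the
  facet argument.\<close>

lemma cover_aff_dim:
  fixes P :: "'a::euclidean_space set"
  assumes "polytope P" "F face_of P" "G face_of P" "F \<subset> G"
    "\<And>K. K face_of P \<Longrightarrow> F \<subset> K \<Longrightarrow> \<not> K \<subset> G"
  shows "aff_dim G = aff_dim F + 1"
proof (cases "F = {}")
  case True
  have pG: "polytope G" using assms(1,3) by (rule face_of_polytope_polytope)
  obtain w where w: "w \<in> vertices G"
    using vertices_nonempty[OF pG] assms(4) by auto
  then have "{w} face_of P" using vertex_face face_of_trans assms(3) by blast
  then have "\<not> {w} \<subset> G" using assms(5) True by blast
  then have "G = {w}" using w vertices_subset by blast
  then show ?thesis using True by simp
next
  case False
  have pG: "polytope G" using assms(1,3) by (rule face_of_polytope_polytope)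
  have "F face_of G" using assms by (meson face_of_subset face_of_imp_subset psubset_imp_subset)
  then obtain K where K: "K facet_of G" "F \<subseteq> K"
    using face_of_polyhedron_subset_facet[OF polytope_imp_polyhedron[OF pG]] False assms(4) by blast
  then have "K face_of P" using assms(3) face_of_trans facet_of_imp_face_of by blast
  moreover have "K \<subset> G" using K by (metis facet_of_imp_subset facet_of_irrefl psubsetI)
  ultimately have "K = F" using K(2) assms(5) by blast
  then show ?thesis using K(1) by (simp add: facet_of_def)
qed

lemma face_subset_aff_dim_less:
  fixes P :: "'a::euclidean_space set"
  assumes "F face_of P" "G face_of P" "F \<subset> G"
  shows "aff_dim F < aff_dim G"
  using assms face_of_aff_dim_lt[of G F]
  by (metis face_of_imp_convex face_of_imp_subset face_of_subset psubset_eq)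

lemma face_cover_exists:
  fixes P :: "'a::euclidean_space set"
  assumes "polytope P" "F face_of P" "F \<noteq> P"
  obtains G where "G face_of P" "F \<subset> G" "\<And>K. K face_of P \<Longrightarrow> F \<subset> K \<Longrightarrow> \<not> K \<subset> G"
proof -
  let ?A = "{G. G face_of P \<and> F \<subset> G}"
  have fin: "finite ?A" using finite_polytope_faces[OF assms(1)] by (rule rev_finite_subset) auto
  have "P \<in> ?A"
    using assms by (simp add: face_of_refl polytope_imp_convex psubsetI face_of_imp_subset)
  then have "?A \<noteq> {}" by blast
  then obtain G where "G \<in> ?A" "\<And>K. K \<in> ?A \<Longrightarrow> K \<subseteq> G \<Longrightarrow> G = K"
    using finite_has_minimal[OF fin] by metis
  then show ?thesis using that by blast
qed

text \<open>Induction downwards from \<open>P\<close>: if \<open>G\<close> covers \<open>F\<close>,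
  then \<open>\<phi> F\<close> covers \<open>\<phi> G\<close>, and each cover changes the dimension
  by one.\<close>

lemma dual_polytope_aff_dim:
  fixes P Pd :: "'a::euclidean_space set"
  assumes "polytope P" "polytope Pd"
    and bij: "bij_betw \<phi> {F. F face_of P} {G. G face_of Pd}"
    and ord: "\<And>F F'. F face_of P \<Longrightarrow> F' face_of P \<Longrightarrow> F \<subseteq> F' \<longleftrightarrow> \<phi> F' \<subseteq> \<phi> F"
    and "F face_of P"
  shows "aff_dim (\<phi> F) = aff_dim P - aff_dim F - 1"
  using \<open>F face_of P\<close>
proof (induction "nat (aff_dim P - aff_dim F)" arbitrary: F rule: less_induct)
  case less
  have PP: "P face_of P" by (simp add: assms(1) face_of_refl polytope_imp_convex)
  have img: "\<phi> K face_of Pd" if "K face_of P" for K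
    using bij that by (auto simp: bij_betw_def)
  have sord: "\<phi> K' \<subset> \<phi> K \<longleftrightarrow> K \<subset> K'" if "K face_of P" "K' face_of P" for K K'
    using ord[OF that] ord[OF that(2,1)] by blast
  show ?case
  proof (cases "F = P")
    case True
    \<comment> \<open>Some face is mapped to the empty face; \<open>P\<close> contains it, so
      \<open>P\<close> is mapped to the empty face too, of dimension -1.\<close>
    obtain K where K: "K face_of P" "\<phi> K = {}"
      using bij unfolding bij_betw_def by (metis (mono_tags) empty_face_of imageE mem_Collect_eq)
    have "\<phi> P \<subseteq> \<phi> K" using ord[OF K(1) PP] face_of_imp_subset K(1) by blast
    then show ?thesis using True K by simp
  next
    case False
    obtain G where G: "G face_of P" "F \<subset> G" "\<And>K. K face_of P \<Longrightarrow> F \<subset> K \<Longrightarrow> \<not> K \<subset> G"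
      using face_cover_exists[OF assms(1) less.prems False] by blast
    have dG: "aff_dim G = aff_dim F + 1" by (rule cover_aff_dim[OF assms(1) less.prems G])
    have "aff_dim G \<le> aff_dim P" by (simp add: G(1) aff_dim_subset face_of_imp_subset)
    then have IH: "aff_dim (\<phi> G) = aff_dim P - aff_dim G - 1"
      using dG by (intro less.hyps G(1)) auto
    have "aff_dim (\<phi> F) = aff_dim (\<phi> G) + 1"
    proof (rule cover_aff_dim[OF assms(2)])
      show "\<phi> G face_of Pd" "\<phi> F face_of Pd" using img G(1) less.prems by auto
      show "\<phi> G \<subset> \<phi> F" using sord[OF less.prems G(1)] G(2) by blast
      fix K assume "K face_of Pd" "\<phi> G \<subset> K"
      then obtain L where L: "L face_of P" "K = \<phi> L"
        using bij by (metis (mono_tags) bij_betw_def imageE mem_Collect_eq)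
      then have "L \<subset> G" using sord[OF L(1) G(1)] \<open>\<phi> G \<subset> K\<close> by blast
      then have "\<not> F \<subset> L" using G(3)[OF L(1)] by blast
      then show "\<not> K \<subset> \<phi> F" using sord[OF less.prems L(1)] L by blast
    qed
    then show ?thesis using IH dG by simp
  qed
qed

section \<open>The toric recursion on dual face lattices\<close>

text \<open>The passage from h to g in \<open>toric_g\<close>, with the dimension as an explicit
  argument, so that it also applies to intervals of a lattice.\<close>

definition trunc_diff :: "nat \<Rightarrow> real poly \<Rightarrow> real poly" where
  "trunc_diff n q = Poly (g_vec (coeffs_from_top n q))"

text \<open>\<open>dual_g P F\<close> is $g(\partial (P/F)^*, x)$ and \<open>dual_h P F\<close> is $h(\partial (P/F)^*, x)$:
  the faces of $(P/F)^*$ are the faces of \<open>P\<close> containing \<open>F\<close>, with the order reversed.\<close>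

function dual_g :: "'a::euclidean_space set \<Rightarrow> 'a set \<Rightarrow> real poly" where
  "dual_g P F = (if polytope P \<and> F face_of P \<and> F \<noteq> P
     then trunc_diff (nat (aff_dim P - aff_dim F - 1))
       (\<Sum>G\<in>{G. G face_of P \<and> F \<subset> G}. dual_g P G * [:-1, 1:] ^ nat (aff_dim G - aff_dim F - 1))
     else 1)"
  by pat_completeness auto
termination
proof (relation "Wellfounded.measure (\<lambda>(P, F). nat (aff_dim P - aff_dim F))", goal_cases)
  case (2 P F G)
  then have "aff_dim F < aff_dim G" "aff_dim G \<le> aff_dim P"
    by (auto intro: face_subset_aff_dim_less simp: aff_dim_subset face_of_imp_subset)
  then show ?case by simp
qed auto

declare dual_g.simps [simp del]

definition dual_h :: "'a::euclidean_space set \<Rightarrow> 'a set \<Rightarrow> real poly" where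
  "dual_h P F = (\<Sum>G\<in>{G. G face_of P \<and> F \<subset> G}. dual_g P G * [:-1, 1:] ^ nat (aff_dim G - aff_dim F - 1))"

lemma dual_g_self [simp]: "dual_g P P = 1"
  by (simp add: dual_g.simps)

lemma dual_g_eq:
  "polytope P \<Longrightarrow> F face_of P \<Longrightarrow> F \<noteq> P \<Longrightarrow>
    dual_g P F = trunc_diff (nat (aff_dim P - aff_dim F - 1)) (dual_h P F)"
  by (simp add: dual_g.simps[of P F] dual_h_def)

text \<open>The toric recursion stripped of geometry, with \<open>\<rho>\<close> in the role of
  dimension. Both \<open>toric_g\<close> on the faces of a polytope and \<open>dual_g\<close> on an
  upper set of faces of \<open>P\<close> are instances.\<close>

definition toric_system ::
  "'b set \<Rightarrow> ('b \<Rightarrow> 'b \<Rightarrow> bool) \<Rightarrow> ('b \<Rightarrow> int) \<Rightarrow> ('b \<Rightarrow> real poly) \<Rightarrow> bool" where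
  "toric_system A lt \<rho> g \<longleftrightarrow> (\<forall>x\<in>A. - 1 \<le> \<rho> x \<and> (\<forall>y\<in>A. lt y x \<longrightarrow> \<rho> y < \<rho> x) \<and>
     g x = (if \<rho> x = - 1 then 1 else trunc_diff (nat (\<rho> x))
       (\<Sum>y\<in>{y\<in>A. lt y x}. g y * [:-1, 1:] ^ nat (\<rho> x - 1 - \<rho> y))))"

text \<open>The recursion at \<open>x\<close> refers only to elements of smaller rank, so induction
  on the rank transports \<open>g\<close>. It is applied to a duality of polytopes and to a
  hyperplane section.\<close>

lemma toric_system_iso:
  assumes A: "toric_system A lt \<rho> g" and B: "toric_system B lt' \<rho>' g'"
    and bij: "bij_betw \<phi> A B"
    and ord: "\<And>x y. x \<in> A \<Longrightarrow> y \<in> A \<Longrightarrow> lt' (\<phi> x) (\<phi> y) \<longleftrightarrow> lt x y"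
    and rank: "\<And>x. x \<in> A \<Longrightarrow> \<rho>' (\<phi> x) = \<rho> x"
    and "x \<in> A"
  shows "g' (\<phi> x) = g x"
  using \<open>x \<in> A\<close>
proof (induction "nat (\<rho> x + 1)" arbitrary: x rule: less_induct)
  case less
  have img: "\<phi> x \<in> B" using bij less.prems by (auto simp: bij_betw_def)
  have IH: "g' (\<phi> y) = g y" if "y \<in> A" "lt y x" for y
  proof (rule less.hyps)
    have "\<rho> y < \<rho> x" "- 1 \<le> \<rho> y" using A that less.prems by (auto simp: toric_system_def)
    then show "nat (\<rho> y + 1) < nat (\<rho> x + 1)" by simp
  qed (rule that)
  have "bij_betw \<phi> {y\<in>A. lt y x} {z\<in>B. lt' z (\<phi> x)}"
    using bij ord less.prems by (auto simp: bij_betw_def inj_on_def)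
  then have "(\<Sum>z\<in>{z\<in>B. lt' z (\<phi> x)}. g' z * [:-1, 1:] ^ nat (\<rho>' (\<phi> x) - 1 - \<rho>' z)) =
      (\<Sum>y\<in>{y\<in>A. lt y x}. g' (\<phi> y) * [:-1, 1:] ^ nat (\<rho>' (\<phi> x) - 1 - \<rho>' (\<phi> y)))"
    by (rule sum.reindex_bij_betw[symmetric])
  also have "\<dots> = (\<Sum>y\<in>{y\<in>A. lt y x}. g y * [:-1, 1:] ^ nat (\<rho> x - 1 - \<rho> y))"
    using less.prems by (intro sum.cong) (auto simp: IH rank)
  finally have eq: "(\<Sum>z\<in>{z\<in>B. lt' z (\<phi> x)}. g' z * [:-1, 1:] ^ nat (\<rho>' (\<phi> x) - 1 - \<rho>' z)) =
      (\<Sum>y\<in>{y\<in>A. lt y x}. g y * [:-1, 1:] ^ nat (\<rho> x - 1 - \<rho> y))" .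
  have gx: "g x = (if \<rho> x = - 1 then 1 else trunc_diff (nat (\<rho> x))
       (\<Sum>y\<in>{y\<in>A. lt y x}. g y * [:-1, 1:] ^ nat (\<rho> x - 1 - \<rho> y)))"
    using A less.prems unfolding toric_system_def by blast
  have "g' (\<phi> x) = (if \<rho>' (\<phi> x) = - 1 then 1 else trunc_diff (nat (\<rho>' (\<phi> x)))
       (\<Sum>z\<in>{z\<in>B. lt' z (\<phi> x)}. g' z * [:-1, 1:] ^ nat (\<rho>' (\<phi> x) - 1 - \<rho>' z)))"
    using B img unfolding toric_system_def by blast
  then show ?case unfolding eq unfolding rank[OF less.prems] gx[symmetric] .
qed

text \<open>The rank is the dimension of the dual face corresponding to \<open>F\<close>. Closure of
  \<open>A\<close> under larger faces keeps every term of the recursion at \<open>F\<close> inside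
  \<open>A\<close>, so faces missing a hyperplane may be left out.\<close>

lemma toric_system_dual_g:
  fixes P :: "'a::euclidean_space set"
  assumes "polytope P" "A \<subseteq> {F. F face_of P}"
    and up: "\<And>F G. F \<in> A \<Longrightarrow> G face_of P \<Longrightarrow> F \<subseteq> G \<Longrightarrow> G \<in> A"
  shows "toric_system A (\<lambda>G F. F \<subset> G) (\<lambda>F. aff_dim P - aff_dim F - 1) (dual_g P)"
  unfolding toric_system_def
proof (intro ballI conjI impI)
  fix F assume F: "F \<in> A"
  then have FP: "F face_of P" using assms by blast
  then show "- 1 \<le> aff_dim P - aff_dim F - 1"
    using aff_dim_subset[of F P] face_of_imp_subset by fastforce
  show "aff_dim P - aff_dim G - 1 < aff_dim P - aff_dim F - 1" if "G \<in> A" "F \<subset> G" for G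
    using that assms FP face_subset_aff_dim_less[of F P G] by auto
  have eq: "{G \<in> A. F \<subset> G} = {G. G face_of P \<and> F \<subset> G}"
    using up[OF F] assms(2) by blast
  have "aff_dim P - aff_dim F - 1 = - 1 \<longleftrightarrow> F = P"
    using face_of_aff_dim_lt[OF polytope_imp_convex[OF assms(1)] FP] by force
  moreover have "dual_h P F = (\<Sum>G\<in>{G \<in> A. F \<subset> G}. dual_g P G *
      [:-1, 1:] ^ nat (aff_dim P - aff_dim F - 1 - 1 - (aff_dim P - aff_dim G - 1)))"
    unfolding eq dual_h_def by (intro sum.cong) (auto simp: algebra_simps)
  ultimately show "dual_g P F = (if aff_dim P - aff_dim F - 1 = - 1 then 1
      else trunc_diff (nat (aff_dim P - aff_dim F - 1)) (\<Sum>G\<in>{G \<in> A. F \<subset> G}. dual_g P G *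
      [:-1, 1:] ^ nat (aff_dim P - aff_dim F - 1 - 1 - (aff_dim P - aff_dim G - 1))))"
    using dual_g_eq[OF assms(1) FP] by simp
qed

lemma face_of_face_psubset:
  "G face_of Y \<Longrightarrow> {F. F face_of G \<and> F \<noteq> G} = {F \<in> {F. F face_of Y}. F \<subset> G}"
  using face_of_face by blast

lemma toric_system_toric_g:
  fixes Y :: "'a::euclidean_space set"
  assumes "polytope Y"
  shows "toric_system {G. G face_of Y} (\<subset>) aff_dim toric_g"
  unfolding toric_system_def
proof (intro ballI conjI impI)
  fix G assume "G \<in> {G. G face_of Y}"
  then have G: "G face_of Y" by blast
  show "- 1 \<le> aff_dim G" by (rule aff_dim_geq)
  show "aff_dim F < aff_dim G" if "F \<in> {G. G face_of Y}" "F \<subset> G" for F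
    using that G face_subset_aff_dim_less[of F Y G] by auto
  have "polytope G" using assms G by (rule face_of_polytope_polytope)
  then have "toric_h G = (\<Sum>F\<in>{F \<in> {F. F face_of Y}. F \<subset> G}.
      toric_g F * [:-1, 1:] ^ nat (aff_dim G - 1 - aff_dim F))"
    by (simp only: toric_h.simps[of G] if_True face_of_face_psubset[OF G])
  then show "toric_g G = (if aff_dim G = - 1 then 1 else trunc_diff (nat (aff_dim G))
      (\<Sum>F\<in>{F \<in> {F. F face_of Y}. F \<subset> G}. toric_g F * [:-1, 1:] ^ nat (aff_dim G - 1 - aff_dim F)))"
    by (simp add: toric_g.simps[of G] trunc_diff_def aff_dim_empty)
qed

text \<open>Once g is transported, the sums match term by term: the excluded face \<open>Pd\<close>
  is the image of the empty face, and both exponents of x - 1 equal the dimension of the face of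
  \<open>P\<close>.\<close>

lemma dual_polytope_toric_h:
  fixes P Pd :: "'a::euclidean_space set"
  assumes "dual_polytope P Pd"
  shows "toric_h Pd = dual_h P {}" "aff_dim Pd = aff_dim P"
proof -
  obtain \<phi> where P: "polytope P" "polytope Pd"
    and bij: "bij_betw \<phi> {F. F face_of P} {G. G face_of Pd}"
    and ord: "\<And>F F'. F face_of P \<Longrightarrow> F' face_of P \<Longrightarrow> F \<subseteq> F' \<longleftrightarrow> \<phi> F' \<subseteq> \<phi> F"
    using assms unfolding dual_polytope_def by blast
  have dim: "aff_dim (\<phi> F) = aff_dim P - aff_dim F - 1" if "F face_of P" for F
    by (rule dual_polytope_aff_dim[OF P bij ord that])
  have sord: "\<phi> K' \<subset> \<phi> K \<longleftrightarrow> K \<subset> K'" if "K face_of P" "K' face_of P" for K K'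
    using ord[OF that] ord[OF that(2,1)] by blast
  have g: "toric_g (\<phi> F) = dual_g P F" if "F face_of P" for F
  proof (rule toric_system_iso[OF toric_system_dual_g toric_system_toric_g bij])
    show "polytope P" "polytope Pd" by (fact P)+
    show "F \<in> {F. F face_of P}" using that by simp
    show "(\<phi> x \<subset> \<phi> y) \<longleftrightarrow> (y \<subset> x)" if "x \<in> {F. F face_of P}" "y \<in> {F. F face_of P}" for x y
      using that sord[of y x] by simp
  qed (auto simp: dim)
  obtain K where K: "K face_of P" "\<phi> K = Pd"
    using bij face_of_refl[OF polytope_imp_convex[OF P(2)]] unfolding bij_betw_def
    by (metis (mono_tags) imageE mem_Collect_eq)
  have "\<phi> {} face_of Pd" using bij by (auto simp: bij_betw_def)
  then have top: "\<phi> {} = Pd"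
    using ord[of "{}" K] K face_of_imp_subset by blast
  then show dimPd: "aff_dim Pd = aff_dim P" using dim[of "{}"] by simp
  have bij': "bij_betw \<phi> {F. F face_of P \<and> {} \<subset> F} {G. G face_of Pd \<and> G \<noteq> Pd}"
  proof -
    have inj: "inj_on \<phi> {F. F face_of P}" and img: "\<phi> ` {F. F face_of P} = {G. G face_of Pd}"
      using bij by (auto simp: bij_betw_def)
    have "\<phi> ` ({F. F face_of P} - {{}}) = {G. G face_of Pd} - {Pd}"
      using inj_on_image_set_diff[OF inj, of "{F. F face_of P}" "{{}}"] img top by auto
    moreover have "{F. F face_of P} - {{}} = {F. F face_of P \<and> {} \<subset> F}"
      "{G. G face_of Pd} - {Pd} = {G. G face_of Pd \<and> G \<noteq> Pd}" by auto
    ultimately show ?thesis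
      using inj_on_diff[OF inj, of "{{}}"] by (simp add: bij_betw_def)
  qed
  have "toric_h Pd = (\<Sum>F\<in>{F. F face_of P \<and> {} \<subset> F}.
      toric_g (\<phi> F) * [:-1, 1:] ^ nat (aff_dim Pd - 1 - aff_dim (\<phi> F)))"
    using P(2) sum.reindex_bij_betw[OF bij',
        of "\<lambda>G. toric_g G * [:-1, 1:] ^ nat (aff_dim Pd - 1 - aff_dim G)"]
    by (simp add: toric_h.simps[of Pd])
  also have "\<dots> = dual_h P {}"
    unfolding dual_h_def by (intro sum.cong) (auto simp: g dim dimPd)
  finally show "toric_h Pd = dual_h P {}" .
qed

section \<open>Palindromic polynomials and the operators\<close>

definition palindromic :: "nat \<Rightarrow> real poly \<Rightarrow> bool" where
  "palindromic n q \<longleftrightarrow> (\<forall>i\<le>n. coeff q (n - i) = coeff q i) \<and> (\<forall>i>n. coeff q i = 0)"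

lemma length_coeffs_from_top [simp]: "length (coeffs_from_top n q) = Suc n"
  by (simp add: coeffs_from_top_def)

lemma nth_coeffs_from_top [simp]: "i \<le> n \<Longrightarrow> coeffs_from_top n q ! i = coeff q (n - i)"
  by (simp add: coeffs_from_top_def del: upt_Suc)

lemma coeffs_from_top_palindromic:
  "palindromic n q \<Longrightarrow> coeffs_from_top n q = map (coeff q) [0..<Suc n]"
  by (simp add: coeffs_from_top_def palindromic_def del: upt_Suc)

lemma length_g_vec [simp]: "length (g_vec (coeffs_from_top n q)) = Suc (n div 2)"
  by (simp add: g_vec_def)

text \<open>\<open>g_vec\<close> takes differences from the leading coefficient on; the symmetry
  moves them to the constant end, so the result is (1 - x) q cut off after degree
  \<open>n div 2\<close>.\<close>

lemma coeff_trunc_diff: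
  assumes "palindromic n q"
  shows "coeff (trunc_diff n q) i =
    (if i \<le> n div 2 then coeff q i - (if i = 0 then 0 else coeff q (i - 1)) else 0)"
proof -
  have "g_vec (coeffs_from_top n q) ! i = coeff q i - (if i = 0 then 0 else coeff q (i - 1))"
    if "i \<le> n div 2"
  proof -
    have "i \<le> n" "i - 1 \<le> n" using that by auto
    then have *: "coeff q (n - i) = coeff q i" "coeff q (n - (i - 1)) = coeff q (i - 1)"
      "coeff q n = coeff q 0"
      using assms unfolding palindromic_def by (metis diff_zero le0)+
    show ?thesis
      using that \<open>i \<le> n\<close> \<open>i - 1 \<le> n\<close> *
      by (cases i) (simp_all add: g_vec_def Suc_diff_Suc del: upt_Suc)
  qed
  then show ?thesis
    by (simp add: trunc_diff_def coeff_Poly_eq nth_default_def less_Suc_eq_le)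
qed

lemma g_vec_nth:
  "i \<le> n div 2 \<Longrightarrow> g_vec (coeffs_from_top n q) ! i = coeff (trunc_diff n q) i"
  by (simp add: trunc_diff_def coeff_Poly_eq nth_default_def less_Suc_eq_le)

lemma coeff_trunc_diff_eq_0: "n div 2 < i \<Longrightarrow> coeff (trunc_diff n q) i = 0"
  by (simp add: trunc_diff_def coeff_Poly_eq nth_default_def)

lemma coeff_linear_mult:
  "coeff ([:-1, 1:] * q) i = (if i = 0 then 0 else coeff q (i - 1)) - (coeff q i :: real)"
  by (cases i) (simp_all add: mult_pCons_left)

text \<open>The contribution of a vertex figure with h-polynomial \<open>q\<close> to the sweep
  identity; for palindromic \<open>q\<close> it is the polynomial form of
  \<open>op_c\<close>.\<close>

definition c_poly :: "nat \<Rightarrow> real poly \<Rightarrow> real poly" where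
  "c_poly n q = 2 * trunc_diff n q + [:-1, 1:] * q"

text \<open>For palindromic \<open>q\<close>, (x - 1) q changes sign when the index \<open>i\<close>
  is reflected to \<open>Suc n - i\<close>, and its lower half is minus the truncated
  difference.\<close>

lemma coeff_linear_mult_palindromic:
  assumes "palindromic n q" "i \<le> Suc n"
  shows "coeff ([:-1, 1:] * q) i = coeff (trunc_diff n q) (Suc n - i) - coeff (trunc_diff n q) i"
proof -
  have sym: "coeff q (n - k) = coeff q k" if "k \<le> n" for k
    using assms that by (simp add: palindromic_def)
  consider "i \<le> n div 2" | "Suc n - i \<le> n div 2" | "i > n div 2" "Suc n - i > n div 2" by linarith
  then show ?thesis
  proof cases
    case 1
    then have "\<not> Suc n - i \<le> n div 2" by linarith
    then show ?thesis using 1 assms by (simp add: coeff_linear_mult coeff_trunc_diff del: mult_pCons_left)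
  next
    case 2
    then have *: "\<not> i \<le> n div 2" "i \<noteq> 0" by linarith+
    then have "coeff q (i - 1) = coeff q (Suc n - i)"
      using sym[of "i - 1"] assms(2) by (simp add: Suc_diff_le)
    moreover have "coeff q i = (if Suc n - i = 0 then 0 else coeff q (Suc n - i - 1))"
    proof (cases "i = Suc n")
      case True
      then show ?thesis using assms(1) by (simp add: palindromic_def)
    next
      case False
      then show ?thesis using sym[of i] assms(2) by simp
    qed
    ultimately show ?thesis
      using * 2 assms by (simp add: coeff_linear_mult coeff_trunc_diff del: mult_pCons_left)
  next
    case 3
    \<comment> \<open>Only the middle index for odd \<open>n\<close> is left; the two neighbouring
      coefficients of \<open>q\<close> are mirror images and cancel.\<close>
    then have "n - i = i - 1" "i > 0" "i \<le> n" using assms(2) by linarith+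
    then have "coeff q (i - 1) = coeff q i" using sym[of i] by simp
    then show ?thesis
      using 3 \<open>i > 0\<close> by (simp add: coeff_linear_mult coeff_trunc_diff_eq_0 del: mult_pCons_left)
  qed
qed

lemma coeff_c_poly:
  assumes "palindromic n q" "i \<le> Suc n"
  shows "coeff (c_poly n q) i = coeff (trunc_diff n q) i + coeff (trunc_diff n q) (Suc n - i)"
proof -
  have "coeff (c_poly n q) i = 2 * coeff (trunc_diff n q) i + coeff ([:-1, 1:] * q) i"
    unfolding c_poly_def coeff_add
    by (simp only: mult_2 coeff_add)
  then show ?thesis using coeff_linear_mult_palindromic[OF assms] by simp
qed

lemma palindromic_c_poly:
  assumes "palindromic n q"
  shows "palindromic (Suc n) (c_poly n q)"
  unfolding palindromic_def
proof (intro conjI allI impI)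
  fix i assume "i \<le> Suc n"
  then show "coeff (c_poly n q) (Suc n - i) = coeff (c_poly n q) i"
    by (simp add: coeff_c_poly[OF assms])
next
  fix i assume "Suc n < i"
  then show "coeff (c_poly n q) i = 0"
    unfolding c_poly_def mult_2 coeff_add
    using assms by (simp add: coeff_trunc_diff_eq_0 coeff_linear_mult palindromic_def del: mult_pCons_left)
qed

section \<open>The operators on coefficient lists\<close>

lemma length_op_c: "length (op_c (coeffs_from_top n q)) = n + 2"
  unfolding op_c_def by simp presburger

text \<open>The ranges are the initial copy of g, the reversed copy and the zero in the middle. Each
  summand on the right vanishes outside its own copy, so one formula covers all three.\<close>

lemma op_c_nth:
  assumes "i \<le> Suc n"
  shows "op_c (coeffs_from_top n q) ! i =
    coeff (trunc_diff n q) i + coeff (trunc_diff n q) (Suc n - i)"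
proof -
  let ?g = "g_vec (coeffs_from_top n q)"
  consider "i \<le> n div 2" | "Suc n - i \<le> n div 2" | "i > n div 2" "Suc n - i > n div 2" by linarith
  then show ?thesis
  proof cases
    case 1
    then have "n div 2 < Suc n - i" by linarith
    then show ?thesis using 1
      by (simp add: op_c_def nth_append g_vec_nth coeff_trunc_diff_eq_0)
  next
    case 2
    then have *: "n div 2 < i" by linarith
    show ?thesis
    proof (cases "even n")
      case True
      then have "op_c (coeffs_from_top n q) ! i = rev ?g ! (i - Suc (n div 2))"
        using * by (simp add: op_c_def nth_append)
      also have "\<dots> = ?g ! (Suc n - i)"
      proof -
        have "i - Suc (n div 2) < Suc (n div 2)"
          using True assms * by (auto elim!: evenE)
        moreover have "Suc (n div 2) - Suc (i - Suc (n div 2)) = Suc n - i"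
          using True assms * by (auto elim!: evenE)
        ultimately show ?thesis by (simp add: rev_nth)
      qed
      finally show ?thesis using 2 * by (simp add: g_vec_nth coeff_trunc_diff_eq_0)
    next
      case False
      then have i: "Suc (n div 2) < i" using 2 assms by (auto elim!: oddE)
      \<comment> \<open>The inserted zero shifts the reversed copy one place further than for even
        \<open>n\<close>.\<close>
      then have "op_c (coeffs_from_top n q) ! i = rev ?g ! (i - Suc (Suc (n div 2)))"
        using False * by (simp add: op_c_def nth_append nth_Cons')
      also have "\<dots> = ?g ! (Suc n - i)"
      proof -
        have "i - Suc (Suc (n div 2)) < Suc (n div 2)"
          using False assms i by (auto elim!: oddE)
        moreover have "Suc (n div 2) - Suc (i - Suc (Suc (n div 2))) = Suc n - i"
          using False assms i by (auto elim!: oddE)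
        ultimately show ?thesis by (simp add: rev_nth)
      qed
      finally show ?thesis using 2 * by (simp add: g_vec_nth coeff_trunc_diff_eq_0)
    qed
  next
    case 3
    then have "odd n" "i = Suc (n div 2)" using assms by presburger+
    then show ?thesis using 3
      by (simp add: op_c_def nth_append coeff_trunc_diff_eq_0)
  qed
qed

lemma op_c_eq:
  assumes "palindromic n q"
  shows "op_c (coeffs_from_top n q) = coeffs_from_top (Suc n) (c_poly n q)"
proof (rule nth_equalityI)
  show "length (op_c (coeffs_from_top n q)) = length (coeffs_from_top (Suc n) (c_poly n q))"
    by (simp add: length_op_c)
next
  fix i assume "i < length (op_c (coeffs_from_top n q))"
  then have "i \<le> Suc n" by (simp add: length_op_c)
  then show "op_c (coeffs_from_top n q) ! i = coeffs_from_top (Suc n) (c_poly n q) ! i"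
    by (simp add: op_c_nth coeff_c_poly[OF assms])
qed

lemma op_d_nth:
  assumes "i \<le> n + 2"
  shows "op_d (coeffs_from_top n q) ! i =
    (if even n \<and> i = Suc (n div 2) then coeff (trunc_diff n q) (n div 2) else 0)"
proof (cases "even n")
  case True
  have "op_d (coeffs_from_top n q) = replicate (Suc (n div 2)) 0
      @ [g_vec (coeffs_from_top n q) ! (n div 2)] @ replicate (Suc (n div 2)) 0"
    using True by (simp add: op_d_def)
  also have "\<dots> ! i = (if i = Suc (n div 2) then coeff (trunc_diff n q) (n div 2) else 0)"
    using assms True by (auto simp: nth_append nth_Cons' g_vec_nth simp del: replicate_Suc elim!: evenE)
  finally show ?thesis using True by simp
next
  case False
  then show ?thesis using assms by (simp add: op_d_def del: replicate_Suc)
qed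

text \<open>\<open>c_poly n q\<close> starts with the coefficients of g =
  \<open>trunc_diff n q\<close>, so its own truncated difference starts like (1 - x) g. Adding (x -
  1) g cancels everything, except that for even \<open>n\<close> the cut-off comes one degree early
  and leaves the coefficient of g at \<open>n div 2\<close> in the middle.\<close>

lemma op_d_coeff:
  assumes "palindromic n q" "i \<le> n + 2"
  shows "op_d (coeffs_from_top n q) ! i =
    coeff (trunc_diff (Suc n) (c_poly n q) + [:-1, 1:] * trunc_diff n q) i"
proof -
  note td = coeff_trunc_diff[OF palindromic_c_poly[OF assms(1)]]
  let ?t = "coeff (trunc_diff n q)"
  have low: "coeff (c_poly n q) k = ?t k" if "k \<le> n div 2" for k
  proof -
    have "n div 2 < Suc n - k" "k \<le> Suc n" using that by linarith+
    then show ?thesis using coeff_c_poly[OF assms(1), of k] by (simp add: coeff_trunc_diff_eq_0)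
  qed
  have mid: "coeff (c_poly n q) (Suc (n div 2)) = 0" if "odd n"
  proof -
    have "Suc n - Suc (n div 2) = Suc (n div 2)" using that by (auto elim!: oddE)
    then show ?thesis
      using coeff_c_poly[OF assms(1), of "Suc (n div 2)"] by (simp add: coeff_trunc_diff_eq_0)
  qed
  consider "i \<le> n div 2" | "i = Suc (n div 2)" | "Suc (n div 2) < i" by linarith
  then show ?thesis
  proof cases
    case 1
    then have "i \<le> Suc n div 2" "i - 1 \<le> n div 2" by linarith+
    then show ?thesis
      using 1 assms(2) by (simp add: op_d_nth coeff_linear_mult td low del: mult_pCons_left)
  next
    case 2
    show ?thesis
    proof (cases "even n")
      case True
      then have "\<not> i \<le> Suc n div 2" using 2 by auto
      then show ?thesis
        using True 2 assms(2) by (simp add: op_d_nth coeff_linear_mult td coeff_trunc_diff_eq_0 del: mult_pCons_left)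
    next
      case False
      then have "i \<le> Suc n div 2" using 2 by (auto elim!: oddE)
      then show ?thesis
        using False 2 assms(2)
        by (simp add: op_d_nth coeff_linear_mult td coeff_trunc_diff_eq_0 mid low del: mult_pCons_left)
    qed
  next
    case 3
    then have "\<not> i \<le> Suc n div 2" "n div 2 < i - 1" "n div 2 < i" by linarith+
    then show ?thesis
      using 3 assms(2) by (simp add: op_d_nth coeff_linear_mult td coeff_trunc_diff_eq_0 del: mult_pCons_left)
  qed
qed

text \<open>Expanding \<open>c_poly\<close> twice gives twice the polynomial of
  \<open>op_d_coeff\<close> plus (x - 1)^2 q; only the latter survives the subtraction.\<close>

lemma op_2d_minus_cc:
  assumes "palindromic n q" "i \<le> n + 2"
  shows "2 * op_d (coeffs_from_top n q) ! i - op_c (op_c (coeffs_from_top n q)) ! i =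
    - coeff ([:-1, 1:] ^ 2 * q) i"
proof -
  have pal: "palindromic (Suc (Suc n)) (c_poly (Suc n) (c_poly n q))"
    using assms(1) by (intro palindromic_c_poly)
  have "op_c (op_c (coeffs_from_top n q)) ! i = coeff (c_poly (Suc n) (c_poly n q)) i"
    using pal assms(2)
    by (simp add: op_c_eq[OF assms(1)] op_c_eq[OF palindromic_c_poly[OF assms(1)]] palindromic_def)
  moreover have "c_poly (Suc n) (c_poly n q) =
      2 * (trunc_diff (Suc n) (c_poly n q) + [:-1, 1:] * trunc_diff n q) + [:-1, 1:] ^ 2 * q"
    unfolding c_poly_def[of "Suc n"] unfolding c_poly_def[of n q, THEN arg_cong, of "\<lambda>u. [:-1, 1:] * u"]
    by (simp only: power2_eq_square algebra_simps)
  ultimately show ?thesis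
    using op_d_coeff[OF assms] by (simp only: coeff_add mult_2)
qed

lemma palindromic_linear_sq:
  assumes "palindromic n q"
  shows "palindromic (n + 2) ([:-1, 1:] ^ 2 * q)"
proof -
  have *: "coeff ([:-1, 1:] ^ 2 * q) i =
     (if i < 2 then 0 else coeff q (i - 2)) - 2 * (if i = 0 then 0 else coeff q (i - 1)) + coeff q i" for i
    unfolding power2_eq_square mult.assoc coeff_linear_mult
    by (cases i) (auto simp: numeral_2_eq_2)
  have sym: "coeff q (n - k) = coeff q k" if "k \<le> n" for k
    using assms that by (simp add: palindromic_def)
  have z: "coeff q k = 0" if "k > n" for k
    using assms that by (simp add: palindromic_def)
  show ?thesis unfolding palindromic_def
  proof (intro conjI allI impI)
    fix i assume i: "i \<le> n + 2"
    \<comment> \<open>The factor (x - 1)^2 has the symmetric coefficients 1, -2, 1: reflecting the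
      index exchanges the outer terms and fixes the middle one.\<close>
    have 1: "(if n + 2 - i < 2 then 0 else coeff q (n + 2 - i - 2)) = coeff q i"
    proof (cases "i \<le> n")
      case True
      then show ?thesis using sym[of i] by (simp add: Suc_diff_le)
    qed (use i z in auto)
    have 2: "(if n + 2 - i = 0 then 0 else coeff q (n + 2 - i - 1)) = (if i = 0 then 0 else coeff q (i - 1))"
    proof (cases "i = 0 \<or> i = n + 2")
      case False
      then have "n - (i - 1) = n + 2 - i - 1" "i - 1 \<le> n" using i by auto
      then show ?thesis using sym[of "i - 1"] False i by simp
    qed (use z in auto)
    have 3: "coeff q (n + 2 - i) = (if i < 2 then 0 else coeff q (i - 2))"
    proof (cases "i < 2")
      case False
      then have "n - (i - 2) = n + 2 - i" "i - 2 \<le> n" using i by auto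
      then show ?thesis using sym[of "i - 2"] False by simp
    qed (use z in auto)
    show "coeff ([:-1, 1:] ^ 2 * q) (n + 2 - i) = coeff ([:-1, 1:] ^ 2 * q) i"
      unfolding * using 1 2 3 by simp
  qed (simp add: * z)
qed

section \<open>Sweeping\<close>

text \<open>A cut preserves order and codimension among the faces it meets, and codimension
  determines the rank in the dual. These faces form an upper set, so both sides solve isomorphic
  systems.\<close>

lemma dual_g_section:
  fixes P :: "'a::euclidean_space set"
  assumes "polytope P" "\<And>w. w \<in> vertices P \<Longrightarrow> a \<bullet> w \<noteq> c" "F face_of P"
    "F \<inter> {x. a \<bullet> x = c} \<noteq> {}"
  shows "dual_g (P \<inter> {x. a \<bullet> x = c}) (F \<inter> {x. a \<bullet> x = c}) = dual_g P F"
proof -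
  let ?H = "{x. a \<bullet> x = c}"
  let ?A = "{F. F face_of P \<and> F \<inter> ?H \<noteq> {}}" and ?B = "{K. K face_of (P \<inter> ?H) \<and> K \<noteq> {}}"
  have A: "toric_system ?A (\<lambda>G F. F \<subset> G) (\<lambda>F. aff_dim P - aff_dim F - 1) (dual_g P)"
    by (rule toric_system_dual_g[OF assms(1)]) auto
  have B: "toric_system ?B (\<lambda>G F. F \<subset> G) (\<lambda>F. aff_dim (P \<inter> ?H) - aff_dim F - 1) (dual_g (P \<inter> ?H))"
    by (rule toric_system_dual_g[OF polytope_hyperplane_section[OF assms(1)]]) auto
  have PP: "P face_of P" "P \<inter> ?H \<noteq> {}"
    using assms(1,3,4) face_of_imp_subset by (auto intro: face_of_refl polytope_imp_convex)
  show ?thesis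
  proof (rule toric_system_iso[OF A B section_faces_bij[OF assms(1,2)]])
    fix F G assume "F \<in> ?A" "G \<in> ?A"
    then have F: "F face_of P" "F \<inter> ?H \<noteq> {}" and G: "G face_of P" "G \<inter> ?H \<noteq> {}" by auto
    show "G \<inter> ?H \<subset> F \<inter> ?H \<longleftrightarrow> G \<subset> F"
      using section_faces_order[OF assms(1,2) F G(1)] section_faces_order[OF assms(1,2) G F(1)]
      by (simp only: less_le_not_le)
  next
    fix F assume "F \<in> ?A"
    then show "aff_dim (P \<inter> ?H) - aff_dim (F \<inter> ?H) - 1 = aff_dim P - aff_dim F - 1"
      using aff_dim_section_face[OF assms(1,2), of F] aff_dim_section_face[OF assms(1,2) PP] by auto
  qed (use assms in auto)
qed

lemma dual_h_section:
  fixes P :: "'a::euclidean_space set"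
  assumes "polytope P" "\<And>w. w \<in> vertices P \<Longrightarrow> a \<bullet> w \<noteq> c"
  shows "dual_h (P \<inter> {x. a \<bullet> x = c}) {} =
    (\<Sum>F\<in>{F. F face_of P \<and> F \<inter> {x. a \<bullet> x = c} \<noteq> {}}. dual_g P F * [:-1, 1:] ^ nat (aff_dim F - 1))"
proof -
  let ?H = "{x. a \<bullet> x = c}"
  let ?A = "{F. F face_of P \<and> F \<inter> ?H \<noteq> {}}"
  have "dual_h (P \<inter> ?H) {} = (\<Sum>K\<in>{K. K face_of (P \<inter> ?H) \<and> K \<noteq> {}}.
      dual_g (P \<inter> ?H) K * [:-1, 1:] ^ nat (aff_dim K - aff_dim ({} :: 'a set) - 1))"
    unfolding dual_h_def by (intro sum.cong) auto
  also have "\<dots> = (\<Sum>F\<in>?A. dual_g (P \<inter> ?H) (F \<inter> ?H) *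
      [:-1, 1:] ^ nat (aff_dim (F \<inter> ?H) - aff_dim ({} :: 'a set) - 1))"
    by (rule sum.reindex_bij_betw[OF section_faces_bij[OF assms], symmetric])
  also have "\<dots> = (\<Sum>F\<in>?A. dual_g P F * [:-1, 1:] ^ nat (aff_dim F - 1))"
    by (intro sum.cong) (auto simp: dual_g_section[OF assms] aff_dim_section_face[OF assms])
  finally show ?thesis .
qed

lemma vertex_figureE:
  assumes "vertex_figure P v Q"
  obtains a c where "Q = P \<inter> {x. a \<bullet> x = c}" "c < a \<bullet> v"
    "\<And>w. w \<in> vertices P \<Longrightarrow> w \<noteq> v \<Longrightarrow> a \<bullet> w < c"
proof -
  obtain a b c where abc: "P \<inter> {x. a \<bullet> x = b} = {v}" "c < b"
    "\<forall>w\<in>vertices P. w \<noteq> v \<longrightarrow> a \<bullet> w < c" "Q = P \<inter> {x. a \<bullet> x = c}"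
    using assms unfolding vertex_figure_def by (elim exE conjE)
  have "a \<bullet> v = b" using abc(1) by blast
  then show ?thesis using that[of a c] abc by simp
qed

lemma face_other_vertex:
  assumes "polytope P" "F face_of P" "v \<in> F" "F \<noteq> {v}"
  obtains w where "w \<in> vertices F" "w \<noteq> v"
proof -
  have pF: "polytope F" by (rule face_of_polytope_polytope[OF assms(1,2)])
  have "vertices F \<noteq> {v}" "vertices F \<noteq> {}"
    using polytope_eq_singleton_iff[OF pF] vertices_nonempty[OF pF] assms by auto
  then show ?thesis using that by blast
qed

text \<open>The hyperplane has \<open>v\<close> alone on one side, and a face is cut exactly when it
  has vertices on both sides.\<close>

lemma face_meets_vertex_figure:
  fixes P :: "'a::euclidean_space set"
  assumes P: "polytope P" and c: "c < a \<bullet> v" "\<And>w. w \<in> vertices P \<Longrightarrow> w \<noteq> v \<Longrightarrow> a \<bullet> w < c"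
    and F: "F face_of P"
  shows "F \<inter> {x. a \<bullet> x = c} \<noteq> {} \<longleftrightarrow> v \<in> F \<and> F \<noteq> {v}"
proof
  assume ne: "F \<inter> {x. a \<bullet> x = c} \<noteq> {}"
  have vF: "vertices F = vertices P \<inter> F" by (rule vertices_face[OF F])
  have "a \<bullet> w \<noteq> c" if "w \<in> vertices F" for w
    using that c vF by (cases "w = v") force+
  then obtain w1 w2 where w: "w1 \<in> vertices F" "w2 \<in> vertices F" "a \<bullet> w1 < c" "c < a \<bullet> w2"
    using hyperplane_separates_vertices[OF face_of_polytope_polytope[OF P F] _ ne] by metis
  have "w2 = v" using w c(2)[of w2] vF by force
  then show "v \<in> F \<and> F \<noteq> {v}" using w vF by auto
next
  assume v: "v \<in> F \<and> F \<noteq> {v}"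
  then obtain w where w: "w \<in> vertices F" "w \<noteq> v" using face_other_vertex[OF P F] by blast
  then have wF: "w \<in> F" "a \<bullet> w < c" using c(2) vertices_face[OF F] by auto
  obtain t where t: "0 < t" "t < 1" "a \<bullet> ((1 - t) *\<^sub>R w + t *\<^sub>R v) = c"
    using segment_meets_hyperplane[OF wF(2) c(1)] by blast
  have "(1 - t) *\<^sub>R w + t *\<^sub>R v \<in> F"
    using face_of_imp_convex[OF F] wF v t by (auto intro: convexD)
  then show "F \<inter> {x. a \<bullet> x = c} \<noteq> {}" using t by blast
qed

text \<open>A vertex \<open>w\<close> of the figure is cut out of a face through \<open>v\<close>
  with another vertex \<open>u\<close>. The segment from \<open>u\<close> to \<open>v\<close>
  crosses the cut, necessarily in \<open>w\<close>, so equal sweep values at \<open>w\<close> and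
  \<open>v\<close> would extend to \<open>u\<close>, against genericity.\<close>

lemma sweep_avoids_vertex_figure:
  fixes P :: "'a::euclidean_space set"
  assumes P: "polytope P" and gen: "generic_sweep P p" and v: "v \<in> vertices P"
    and Q: "vertex_figure P v Q" and w: "w \<in> vertices Q"
  shows "p \<bullet> w \<noteq> p \<bullet> v"
proof
  assume eq: "p \<bullet> w = p \<bullet> v"
  obtain a c where ac: "Q = P \<inter> {x. a \<bullet> x = c}" "c < a \<bullet> v"
    "\<And>w. w \<in> vertices P \<Longrightarrow> w \<noteq> v \<Longrightarrow> a \<bullet> w < c" using vertex_figureE[OF Q] by metis
  have av: "\<And>w. w \<in> vertices P \<Longrightarrow> a \<bullet> w \<noteq> c" using ac by force
  have "{w} \<in> {K. K face_of (P \<inter> {x. a \<bullet> x = c}) \<and> K \<noteq> {}}"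
    using w by (simp add: vertex_face ac(1))
  then obtain F where F: "F face_of P" "F \<inter> {x. a \<bullet> x = c} \<noteq> {}" "F \<inter> {x. a \<bullet> x = c} = {w}"
    using section_faces_bij[OF P av] unfolding bij_betw_def by (smt (verit) imageE mem_Collect_eq)
  then have vF: "v \<in> F" "F \<noteq> {v}" using face_meets_vertex_figure[OF P ac(2,3) F(1)] by auto
  then obtain u where u: "u \<in> vertices F" "u \<noteq> v" using face_other_vertex[OF P F(1)] by blast
  then have uF: "u \<in> F" "u \<in> vertices P" "a \<bullet> u < c" using ac(3) vertices_face[OF F(1)] by auto
  obtain t where t: "0 < t" "t < 1" "a \<bullet> ((1 - t) *\<^sub>R u + t *\<^sub>R v) = c"
    using segment_meets_hyperplane[OF uF(3) ac(2)] by blast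
  have "(1 - t) *\<^sub>R u + t *\<^sub>R v \<in> F"
    using face_of_imp_convex[OF F(1)] uF vF t by (auto intro: convexD)
  then have "(1 - t) *\<^sub>R u + t *\<^sub>R v = w" using F(3) t by blast
  then have "(1 - t) * (p \<bullet> u) + t * (p \<bullet> v) = p \<bullet> v"
    using eq by (metis inner_add_right inner_scaleR_right)
  then have "(1 - t) * (p \<bullet> u - p \<bullet> v) = 0" by (simp add: algebra_simps)
  then have "p \<bullet> u = p \<bullet> v" using t by simp
  then show False using gen u(2) uF(2) v by (auto simp: generic_sweep_def inj_on_def)
qed

text \<open>If \<open>F\<close> has vertices on both sides of the sweep hyperplane, their segments
  to \<open>v\<close> cross the figure on both sides, and convexity gives a point of the figure on
  the hyperplane. Conversely, vertices of the figure avoid the hyperplane, so a crossing forces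
  points of \<open>F\<close> strictly on both sides.\<close>

lemma face_meets_sweep_section:
  fixes P :: "'a::euclidean_space set"
  assumes P: "polytope P" and gen: "generic_sweep P p" and v: "v \<in> vertices P"
    and Q: "vertex_figure P v Q" and F: "F face_of P" "v \<in> F" "F \<noteq> {v}"
  shows "F \<inter> sweep_section p v Q = {} \<longleftrightarrow>
    (\<forall>w\<in>vertices F. p \<bullet> v \<le> p \<bullet> w) \<or> (\<forall>w\<in>vertices F. p \<bullet> w \<le> p \<bullet> v)"
proof -
  obtain a c where ac: "Q = P \<inter> {x. a \<bullet> x = c}" "c < a \<bullet> v"
    "\<And>w. w \<in> vertices P \<Longrightarrow> w \<noteq> v \<Longrightarrow> a \<bullet> w < c" using vertex_figureE[OF Q] by metis
  have cv: "convex F" using F(1) by (rule face_of_imp_convex)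
  have pF: "polytope F" using P F(1) by (rule face_of_polytope_polytope)
  have FP: "F \<subseteq> P" using F(1) by (rule face_of_imp_subset)
  have vF: "vertices F = vertices P \<inter> F" using F(1) by (rule vertices_face)
  have FR: "F \<inter> sweep_section p v Q = (F \<inter> {x. a \<bullet> x = c}) \<inter> {x. p \<bullet> x = p \<bullet> v}"
    using FP by (auto simp: sweep_section_def ac(1))
  \<comment> \<open>The crossing of the segment from \<open>w\<close> to \<open>v\<close> with the
    cut; as \<open>s\<close> is positive, it lies on the same side of the sweep hyperplane as
    \<open>w\<close>.\<close>
  have cross: "\<exists>z s. z \<in> F \<inter> {x. a \<bullet> x = c} \<and> 0 < s \<and> p \<bullet> z = p \<bullet> v + s * (p \<bullet> w - p \<bullet> v)"
    if "w \<in> vertices F" "w \<noteq> v" for w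
  proof -
    have "w \<in> F" "a \<bullet> w < c" using that vF ac(3) by auto
    obtain t where t: "0 < t" "t < 1" "a \<bullet> ((1 - t) *\<^sub>R w + t *\<^sub>R v) = c"
      using segment_meets_hyperplane[OF \<open>a \<bullet> w < c\<close> ac(2)] by blast
    have "(1 - t) *\<^sub>R w + t *\<^sub>R v \<in> F" using cv \<open>w \<in> F\<close> F(2) t by (auto intro: convexD)
    moreover have "p \<bullet> ((1 - t) *\<^sub>R w + t *\<^sub>R v) = p \<bullet> v + (1 - t) * (p \<bullet> w - p \<bullet> v)"
      by (simp add: inner_add_right algebra_simps)
    ultimately show ?thesis using t
      by (intro exI[of _ "(1 - t) *\<^sub>R w + t *\<^sub>R v"] exI[of _ "1 - t"]) auto
  qed
  show ?thesis
  proof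
    assume dis: "F \<inter> sweep_section p v Q = {}"
    show "(\<forall>w\<in>vertices F. p \<bullet> v \<le> p \<bullet> w) \<or> (\<forall>w\<in>vertices F. p \<bullet> w \<le> p \<bullet> v)"
    proof (rule ccontr)
      assume "\<not> ?thesis"
      then obtain w1 w2 where w: "w1 \<in> vertices F" "w2 \<in> vertices F" "p \<bullet> w1 < p \<bullet> v" "p \<bullet> v < p \<bullet> w2"
        by force
      obtain z1 s1 where z1: "z1 \<in> F \<inter> {x. a \<bullet> x = c}" "0 < s1" "p \<bullet> z1 = p \<bullet> v + s1 * (p \<bullet> w1 - p \<bullet> v)"
        using cross[OF w(1)] w by blast
      obtain z2 s2 where z2: "z2 \<in> F \<inter> {x. a \<bullet> x = c}" "0 < s2" "p \<bullet> z2 = p \<bullet> v + s2 * (p \<bullet> w2 - p \<bullet> v)"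
        using cross[OF w(2)] w by blast
      have "p \<bullet> z1 < p \<bullet> v" "p \<bullet> v < p \<bullet> z2"
        using z1(2,3) z2(2,3) w by (auto simp: mult_pos_neg)
      then obtain t where t: "0 < t" "t < 1" "p \<bullet> ((1 - t) *\<^sub>R z1 + t *\<^sub>R z2) = p \<bullet> v"
        using segment_meets_hyperplane by blast
      have "convex (F \<inter> {x. a \<bullet> x = c})" using cv by (intro convex_Int convex_hyperplane)
      then have "(1 - t) *\<^sub>R z1 + t *\<^sub>R z2 \<in> F \<inter> {x. a \<bullet> x = c}"
        using z1(1) z2(1) t by (intro convexD) auto
      then show False using dis t(3) unfolding FR by blast
    qed
  next
    assume ext: "(\<forall>w\<in>vertices F. p \<bullet> v \<le> p \<bullet> w) \<or> (\<forall>w\<in>vertices F. p \<bullet> w \<le> p \<bullet> v)"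
    show "F \<inter> sweep_section p v Q = {}"
    proof (rule ccontr)
      assume "\<not> ?thesis"
      then have ne: "(F \<inter> {x. a \<bullet> x = c}) \<inter> {x. p \<bullet> x = p \<bullet> v} \<noteq> {}" unfolding FR .
      have FQ: "(F \<inter> {x. a \<bullet> x = c}) face_of Q"
        unfolding ac(1) using F(1) by (intro face_of_slice convex_hyperplane)
      have "p \<bullet> u \<noteq> p \<bullet> v" if "u \<in> vertices (F \<inter> {x. a \<bullet> x = c})" for u
        using sweep_avoids_vertex_figure[OF P gen v Q] that vertices_face[OF FQ] by blast
      then obtain u1 u2 where "u1 \<in> vertices (F \<inter> {x. a \<bullet> x = c})"
        "u2 \<in> vertices (F \<inter> {x. a \<bullet> x = c})" "p \<bullet> u1 < p \<bullet> v" "p \<bullet> v < p \<bullet> u2"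
        using hyperplane_separates_vertices[OF polytope_hyperplane_section[OF pF] _ ne] by metis
      then have u: "u1 \<in> F" "u2 \<in> F" "p \<bullet> u1 < p \<bullet> v" "p \<bullet> v < p \<bullet> u2"
        using vertices_subset[of "F \<inter> {x. a \<bullet> x = c}"] by auto
      have hull: "F = convex hull vertices F" by (rule polytope_eq_hull_vertices[OF pF])
      from ext show False
      proof
        assume "\<forall>w\<in>vertices F. p \<bullet> v \<le> p \<bullet> w"
        then have "convex hull vertices F \<subseteq> {x. p \<bullet> v \<le> p \<bullet> x}"
          by (intro hull_minimal) (auto simp: convex_halfspace_ge[of "p \<bullet> v" p, simplified])
        then show False using hull u by force
      next
        assume "\<forall>w\<in>vertices F. p \<bullet> w \<le> p \<bullet> v"
        then have "convex hull vertices F \<subseteq> {x. p \<bullet> x \<le> p \<bullet> v}"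
          by (intro hull_minimal) (auto simp: convex_halfspace_le)
        then show False using hull u by force
      qed
    qed
  qed
qed

section \<open>Counting faces by their extreme vertices\<close>

text \<open>Stated for an arbitrary generic direction, so that the instance \<open>- p\<close> sorts
  the faces by their maximal vertex.\<close>

lemma sum_faces_by_min_vertex:
  fixes P :: "'a::euclidean_space set" and f :: "'a set \<Rightarrow> 'b::comm_monoid_add"
  assumes P: "polytope P" and gen: "generic_sweep P p"
  shows "(\<Sum>F\<in>{F. F face_of P \<and> F \<noteq> {}}. f F) =
    (\<Sum>v\<in>vertices P. \<Sum>F\<in>{F. F face_of P \<and> v \<in> F \<and> (\<forall>w\<in>vertices F. p \<bullet> v \<le> p \<bullet> w)}. f F)"
proof -
  let ?M = "\<lambda>v. {F. F face_of P \<and> v \<in> F \<and> (\<forall>w\<in>vertices F. p \<bullet> v \<le> p \<bullet> w)}"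
  have "{F. F face_of P \<and> F \<noteq> {}} \<subseteq> (\<Union>v\<in>vertices P. ?M v)"
  proof
    fix F assume "F \<in> {F. F face_of P \<and> F \<noteq> {}}"
    then have F: "F face_of P" "F \<noteq> {}" by auto
    have pF: "polytope F" using P F(1) by (rule face_of_polytope_polytope)
    obtain v where v: "v \<in> vertices F" "\<forall>w\<in>vertices F. p \<bullet> v \<le> p \<bullet> w"
      using ex_is_arg_min_if_finite[OF finite_vertices[OF pF] vertices_nonempty[OF pF F(2)], of "\<lambda>v. p \<bullet> v"]
      by (auto simp: is_arg_min_linorder)
    then show "F \<in> (\<Union>v\<in>vertices P. ?M v)" using F vertices_face[OF F(1)] by auto
  qed
  then have U: "{F. F face_of P \<and> F \<noteq> {}} = (\<Union>v\<in>vertices P. ?M v)" by auto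
  have fin: "finite (?M v)" for v
    using finite_polytope_faces[OF P] by (rule rev_finite_subset) auto
  have disj: "?M v \<inter> ?M w = {}" if "v \<in> vertices P" "w \<in> vertices P" "v \<noteq> w" for v w
  proof (rule ccontr)
    assume "?M v \<inter> ?M w \<noteq> {}"
    then obtain F where "F face_of P" "v \<in> F" "w \<in> F" "\<forall>u\<in>vertices F. p \<bullet> v \<le> p \<bullet> u" "\<forall>u\<in>vertices F. p \<bullet> w \<le> p \<bullet> u"
      by auto
    then have "p \<bullet> v = p \<bullet> w" using that vertices_face[of F P] by (simp add: order_antisym)
    then show False using gen that by (auto simp: generic_sweep_def inj_on_def)
  qed
  show ?thesis unfolding U
    using fin disj finite_vertices[OF P] by (intro sum.UNION_disjoint) auto
qed

text \<open>Inclusion-exclusion for the faces with minimum at \<open>v\<close> and those with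
  maximum at \<open>v\<close>; the intersection contributes the second copy of \<open>f {v}\<close>,
  and the union is written as a difference to bring in the sweep section.\<close>

lemma sum_faces_by_sweep:
  fixes P :: "'a::euclidean_space set" and f :: "'a set \<Rightarrow> real poly"
  assumes P: "polytope P" and gen: "generic_sweep P p"
    and Q: "\<And>v. v \<in> vertices P \<Longrightarrow> vertex_figure P v (Q v)"
  shows "2 * (\<Sum>F\<in>{F. F face_of P \<and> F \<noteq> {}}. f F) =
    (\<Sum>v\<in>vertices P. 2 * f {v} + (\<Sum>F\<in>{F. F face_of P \<and> v \<in> F \<and> F \<noteq> {v}}. f F) -
      (\<Sum>F\<in>{F. F face_of P \<and> v \<in> F \<and> F \<noteq> {v} \<and> F \<inter> sweep_section p v (Q v) \<noteq> {}}. f F))"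
proof -
  let ?M = "\<lambda>v. {F. F face_of P \<and> v \<in> F \<and> (\<forall>w\<in>vertices F. p \<bullet> v \<le> p \<bullet> w)}"
  let ?N = "\<lambda>v. {F. F face_of P \<and> v \<in> F \<and> (\<forall>w\<in>vertices F. p \<bullet> w \<le> p \<bullet> v)}"
  have gen': "generic_sweep P (- p)" using gen by (simp add: generic_sweep_def inj_on_def)
  have finF: "finite {F. F face_of P \<and> R F}" for R
    using finite_polytope_faces[OF P] by (rule rev_finite_subset) auto
  have "sum f (?M v) + sum f (?N v) =
      2 * f {v} + (\<Sum>F\<in>{F. F face_of P \<and> v \<in> F \<and> F \<noteq> {v}}. f F) -
      (\<Sum>F\<in>{F. F face_of P \<and> v \<in> F \<and> F \<noteq> {v} \<and> F \<inter> sweep_section p v (Q v) \<noteq> {}}. f F)"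
    if v: "v \<in> vertices P" for v
  proof -
    let ?A = "{F. F face_of P \<and> v \<in> F \<and> F \<noteq> {v}}"
    let ?X = "{F. F face_of P \<and> v \<in> F \<and> F \<noteq> {v} \<and> F \<inter> sweep_section p v (Q v) \<noteq> {}}"
    have vf: "{v} face_of P" using v by (simp add: vertex_face)
    have inter: "?M v \<inter> ?N v = {{v}}"
    proof
      show "{{v}} \<subseteq> ?M v \<inter> ?N v" using vf by (auto simp: vertices_singleton)
      show "?M v \<inter> ?N v \<subseteq> {{v}}"
      proof
        fix F assume "F \<in> ?M v \<inter> ?N v"
        \<comment> \<open>The sweep is constant on the vertices of such a face, so genericity leaves
          \<open>v\<close> as its only vertex.\<close>
        then have F: "F face_of P" "v \<in> F" "\<forall>w\<in>vertices F. p \<bullet> w = p \<bullet> v"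
          by (auto intro: order_antisym)
        have "F = {v}"
        proof (rule ccontr)
          assume "F \<noteq> {v}"
          then obtain w where "w \<in> vertices F" "w \<noteq> v" using face_other_vertex[OF P F(1,2)] by blast
          then show False
            using F(3) gen v vertices_face[OF F(1)] by (auto simp: generic_sweep_def inj_on_def)
        qed
        then show "F \<in> {{v}}" by simp
      qed
    qed
    have union: "?M v \<union> ?N v = insert {v} (?A - ?X)"
    proof (rule set_eqI)
      fix F
      show "F \<in> ?M v \<union> ?N v \<longleftrightarrow> F \<in> insert {v} (?A - ?X)"
      proof (cases "F = {v}")
        case True then show ?thesis using vf by (auto simp: vertices_singleton)
      next
        case False
        then show ?thesis using face_meets_sweep_section[OF P gen v Q[OF v], of F] by blast
      qed
    qed
    have "sum f (?M v) + sum f (?N v) = sum f (?M v \<union> ?N v) + sum f (?M v \<inter> ?N v)"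
      using finF by (intro sum.union_inter[symmetric])
    also have "\<dots> = f {v} + sum f (?A - ?X) + f {v}"
      unfolding inter union using finF[of "\<lambda>F. v \<in> F \<and> F \<noteq> {v}"] by simp
    also have "sum f (?A - ?X) = sum f ?A - sum f ?X"
      using finF by (intro sum_diff) auto
    finally show ?thesis by simp
  qed
  moreover have "2 * (\<Sum>F\<in>{F. F face_of P \<and> F \<noteq> {}}. f F) =
      (\<Sum>v\<in>vertices P. sum f (?M v) + sum f (?N v))"
  proof -
    have "(\<Sum>F\<in>{F. F face_of P \<and> F \<noteq> {}}. f F) = (\<Sum>v\<in>vertices P. sum f (?N v))"
      using sum_faces_by_min_vertex[OF P gen', of f] by (simp only: inner_minus_left neg_le_iff_le)
    then show ?thesis
      unfolding sum.distrib mult_2 using sum_faces_by_min_vertex[OF P gen, of f] by argo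
  qed
  ultimately show ?thesis by (simp only: cong: sum.cong)
qed

lemma vertex_face_dim_pos:
  fixes P :: "'a::euclidean_space set"
  assumes "F face_of P" "v \<in> F" "F \<noteq> {v}"
  shows "1 \<le> aff_dim F"
proof -
  have "aff_dim F \<noteq> 0" using assms aff_dim_eq_0[of F] by auto
  moreover have "\<not> aff_dim F < 0" using assms(2) by (auto simp: aff_dim_negative_iff)
  ultimately show ?thesis by linarith
qed

section \<open>Vertex figure and sweep section in terms of the faces of P\<close>

text \<open>Nonempty faces of \<open>Q\<close> are traces of the faces of \<open>P\<close> properly
  containing \<open>v\<close>. Multiplying by x - 1 undoes the loss of one dimension and turns
  \<open>dual_h Q {}\<close> into a sum with the exponents of \<open>P\<close>.\<close>

lemma vertex_figure_dual:
  fixes P :: "'a::euclidean_space set"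
  assumes P: "polytope P" and v: "v \<in> vertices P" "P \<noteq> {v}" and Q: "vertex_figure P v Q"
  shows "polytope Q" "aff_dim Q = aff_dim P - 1" "dual_g Q {} = dual_g P {v}"
    "[:-1, 1:] * dual_h Q {} =
      (\<Sum>F\<in>{F. F face_of P \<and> v \<in> F \<and> F \<noteq> {v}}. dual_g P F * [:-1, 1:] ^ nat (aff_dim F))"
    "\<And>F. F face_of P \<Longrightarrow> v \<in> F \<Longrightarrow> F \<noteq> {v} \<Longrightarrow> dual_g Q (F \<inter> Q) = dual_g P F"
    "\<And>F. F face_of P \<Longrightarrow> v \<in> F \<Longrightarrow> F \<noteq> {v} \<Longrightarrow> aff_dim (F \<inter> Q) = aff_dim F - 1"
    "bij_betw (\<lambda>F. F \<inter> Q) {F. F face_of P \<and> v \<in> F \<and> F \<noteq> {v}} {K. K face_of Q \<and> K \<noteq> {}}"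
proof -
  obtain a c where ac: "Q = P \<inter> {x. a \<bullet> x = c}" "c < a \<bullet> v"
    "\<And>w. w \<in> vertices P \<Longrightarrow> w \<noteq> v \<Longrightarrow> a \<bullet> w < c" using vertex_figureE[OF Q] by metis
  let ?H = "{x. a \<bullet> x = c}"
  have av: "\<And>w. w \<in> vertices P \<Longrightarrow> a \<bullet> w \<noteq> c" using ac by force
  have meets: "F \<inter> ?H \<noteq> {} \<longleftrightarrow> v \<in> F \<and> F \<noteq> {v}" if "F face_of P" for F
    by (rule face_meets_vertex_figure[OF P ac(2) ac(3) that])
  have FQ: "F \<inter> Q = F \<inter> ?H" if "F face_of P" for F
    using face_of_imp_subset[OF that] ac(1) by blast
  have A: "{F. F face_of P \<and> F \<inter> ?H \<noteq> {}} = {F. F face_of P \<and> v \<in> F \<and> F \<noteq> {v}}"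
    using meets by blast
  show "polytope Q" unfolding ac(1) by (rule polytope_hyperplane_section[OF P])
  have PP: "P face_of P" using P by (simp add: face_of_refl polytope_imp_convex)
  have vP: "v \<in> P" using v vertices_subset by blast
  show dimF: "aff_dim (F \<inter> Q) = aff_dim F - 1" if "F face_of P" "v \<in> F" "F \<noteq> {v}" for F
    unfolding FQ[OF that(1)] using aff_dim_section_face[OF P av that(1)] meets[OF that(1)] that by blast
  show dimQ: "aff_dim Q = aff_dim P - 1"
    using dimF[OF PP vP v(2)] by (simp add: ac(1) Int_absorb1)
  show gF: "dual_g Q (F \<inter> Q) = dual_g P F" if "F face_of P" "v \<in> F" "F \<noteq> {v}" for F
    unfolding FQ[OF that(1)] unfolding ac(1)
    using dual_g_section[OF P av that(1)] meets[OF that(1)] that by blast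
  have hQ: "dual_h Q {} = (\<Sum>F\<in>{F. F face_of P \<and> v \<in> F \<and> F \<noteq> {v}}. dual_g P F * [:-1, 1:] ^ nat (aff_dim F - 1))"
    unfolding ac(1) A[symmetric] by (rule dual_h_section[OF P av])
  then have "[:-1, 1:] * dual_h Q {} =
      (\<Sum>F\<in>{F. F face_of P \<and> v \<in> F \<and> F \<noteq> {v}}. [:-1, 1:] * (dual_g P F * [:-1, 1:] ^ nat (aff_dim F - 1)))"
    by (simp only: sum_distrib_left)
  also have "\<dots> = (\<Sum>F\<in>{F. F face_of P \<and> v \<in> F \<and> F \<noteq> {v}}. dual_g P F * [:-1, 1:] ^ nat (aff_dim F))"
  proof (rule sum.cong[OF refl])
    fix F assume "F \<in> {F. F face_of P \<and> v \<in> F \<and> F \<noteq> {v}}"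
    then have "1 \<le> aff_dim F" using vertex_face_dim_pos by blast
    then have "nat (aff_dim F) = Suc (nat (aff_dim F - 1))" by simp
    then show "[:-1, 1:] * (dual_g P F * [:-1, 1:] ^ nat (aff_dim F - 1)) = dual_g P F * [:-1, 1:] ^ nat (aff_dim F)"
      by (simp only: power_Suc mult.left_commute)
  qed
  finally show "[:-1, 1:] * dual_h Q {} =
      (\<Sum>F\<in>{F. F face_of P \<and> v \<in> F \<and> F \<noteq> {v}}. dual_g P F * [:-1, 1:] ^ nat (aff_dim F))" .
  have "bij_betw (\<lambda>F. F \<inter> ?H) {F. F face_of P \<and> v \<in> F \<and> F \<noteq> {v}} {K. K face_of Q \<and> K \<noteq> {}}"
    using section_faces_bij[OF P av] unfolding A ac(1) .
  then show "bij_betw (\<lambda>F. F \<inter> Q) {F. F face_of P \<and> v \<in> F \<and> F \<noteq> {v}} {K. K face_of Q \<and> K \<noteq> {}}"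
    by (rule bij_betw_cong[THEN iffD1, rotated]) (use FQ in auto)
  have "{v} face_of P" using v by (simp add: vertex_face)
  have "Q \<noteq> {}" using meets[OF PP] vP v(2) ac(1) by blast
  \<comment> \<open>\<open>{v}\<close> misses the cut, so \<open>dual_g_section\<close> does not
    reach it. Instead the h-polynomials at \<open>{v}\<close> and at the empty face of
    \<open>Q\<close> are the same sum, and the dimensions handed to \<open>trunc_diff\<close>
    agree.\<close>
  have "dual_h P {v} = (\<Sum>F\<in>{F. F face_of P \<and> v \<in> F \<and> F \<noteq> {v}}. dual_g P F * [:-1, 1:] ^ nat (aff_dim F - 1))"
    unfolding dual_h_def by (intro sum.cong) auto
  then have "dual_h P {v} = dual_h Q {}" using hQ by simp
  then show "dual_g Q {} = dual_g P {v}"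
    using dual_g_eq[OF P \<open>{v} face_of P\<close>] dual_g_eq[OF \<open>polytope Q\<close> empty_face_of] v(2) \<open>Q \<noteq> {}\<close> dimQ
    by simp
qed

text \<open>The faces of \<open>P\<close> are cut twice here, hence the square. If the section is
  empty, both sides of the last equation are 0, so the sweep identity holds without a case
  distinction.\<close>

lemma sweep_section_dual:
  fixes P :: "'a::euclidean_space set"
  assumes P: "polytope P" and gen: "generic_sweep P p" and v: "v \<in> vertices P" "P \<noteq> {v}"
    and Q: "vertex_figure P v Q"
  shows "polytope (sweep_section p v Q)"
    "sweep_section p v Q \<noteq> {} \<Longrightarrow> aff_dim (sweep_section p v Q) = aff_dim P - 2"
    "[:-1, 1:] ^ 2 * dual_h (sweep_section p v Q) {} =
      (\<Sum>F\<in>{F. F face_of P \<and> v \<in> F \<and> F \<noteq> {v} \<and> F \<inter> sweep_section p v Q \<noteq> {}}.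
        dual_g P F * [:-1, 1:] ^ nat (aff_dim F))"
proof -
  let ?H = "{x. p \<bullet> x = p \<bullet> v}"
  note vq = vertex_figure_dual[OF P v Q]
  have R: "sweep_section p v Q = Q \<inter> ?H" by (simp add: sweep_section_def)
  have av: "\<And>w. w \<in> vertices Q \<Longrightarrow> p \<bullet> w \<noteq> p \<bullet> v" by (rule sweep_avoids_vertex_figure[OF P gen v(1) Q])
  show "polytope (sweep_section p v Q)" unfolding R by (rule polytope_hyperplane_section[OF vq(1)])
  have QQ: "Q face_of Q" using vq(1) by (simp add: face_of_refl polytope_imp_convex)
  show "aff_dim (sweep_section p v Q) = aff_dim P - 2" if "sweep_section p v Q \<noteq> {}"
    using that aff_dim_section_face[OF vq(1) av QQ] vq(2) by (simp add: R)
  let ?A = "{F. F face_of P \<and> v \<in> F \<and> F \<noteq> {v}}"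
  let ?X = "{F. F face_of P \<and> v \<in> F \<and> F \<noteq> {v} \<and> F \<inter> sweep_section p v Q \<noteq> {}}"
  let ?Y = "{K. K face_of Q \<and> K \<inter> ?H \<noteq> {}}"
  have inj: "inj_on (\<lambda>F. F \<inter> Q) ?A" and img: "(\<lambda>F. F \<inter> Q) ` ?A = {K. K face_of Q \<and> K \<noteq> {}}"
    using vq(7) by (auto simp: bij_betw_def)
  have bij: "bij_betw (\<lambda>F. F \<inter> Q) ?X ?Y"
  proof (rule bij_betw_imageI)
    show "inj_on (\<lambda>F. F \<inter> Q) ?X" by (rule inj_on_subset[OF inj]) auto
    show "(\<lambda>F. F \<inter> Q) ` ?X = ?Y"
    proof
      show "(\<lambda>F. F \<inter> Q) ` ?X \<subseteq> ?Y" using img unfolding R by blast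
      show "?Y \<subseteq> (\<lambda>F. F \<inter> Q) ` ?X"
      proof
        fix K assume K: "K \<in> ?Y"
        then have "K \<in> (\<lambda>F. F \<inter> Q) ` ?A" unfolding img by blast
        then obtain F where "F \<in> ?A" "K = F \<inter> Q" by blast
        then show "K \<in> (\<lambda>F. F \<inter> Q) ` ?X" using K unfolding R by blast
      qed
    qed
  qed
  have "dual_h (sweep_section p v Q) {} = (\<Sum>K\<in>?Y. dual_g Q K * [:-1, 1:] ^ nat (aff_dim K - 1))"
    unfolding R by (rule dual_h_section[OF vq(1) av])
  also have "\<dots> = (\<Sum>F\<in>?X. dual_g Q (F \<inter> Q) * [:-1, 1:] ^ nat (aff_dim (F \<inter> Q) - 1))"
    by (rule sum.reindex_bij_betw[OF bij, symmetric])
  finally have "[:-1, 1:] ^ 2 * dual_h (sweep_section p v Q) {} =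
      (\<Sum>F\<in>?X. [:-1, 1:] ^ 2 * (dual_g Q (F \<inter> Q) * [:-1, 1:] ^ nat (aff_dim (F \<inter> Q) - 1)))"
    by (simp only: sum_distrib_left)
  also have "\<dots> = (\<Sum>F\<in>?X. dual_g P F * [:-1, 1:] ^ nat (aff_dim F))"
  proof (rule sum.cong[OF refl])
    fix F assume F: "F \<in> ?X"
    then have K: "(F \<inter> Q) \<in> ?Y" using bij by (auto simp: bij_betw_def)
    then have "aff_dim (F \<inter> Q \<inter> ?H) = aff_dim (F \<inter> Q) - 1"
      using aff_dim_section_face[OF vq(1) av] by blast
    \<comment> \<open>The twofold cut is nonempty, so \<open>aff_dim F\<close> is at least 2 and
      \<open>nat\<close> truncates nothing.\<close>
    moreover have "0 \<le> aff_dim (F \<inter> Q \<inter> ?H)"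
      using K by (metis (mono_tags, lifting) aff_dim_negative_iff mem_Collect_eq not_less)
    moreover have dF: "aff_dim (F \<inter> Q) = aff_dim F - 1" "dual_g Q (F \<inter> Q) = dual_g P F"
      using F vq(5,6) by auto
    ultimately have "nat (aff_dim F) = 2 + nat (aff_dim (F \<inter> Q) - 1)" by simp
    then show "[:-1, 1:] ^ 2 * (dual_g Q (F \<inter> Q) * [:-1, 1:] ^ nat (aff_dim (F \<inter> Q) - 1)) =
        dual_g P F * [:-1, 1:] ^ nat (aff_dim F)"
      unfolding dF(2) by (simp only: power_add mult.left_commute)
  qed
  finally show "[:-1, 1:] ^ 2 * dual_h (sweep_section p v Q) {} =
      (\<Sum>F\<in>?X. dual_g P F * [:-1, 1:] ^ nat (aff_dim F))" .
qed

section \<open>Palindromicity and the sweep formula\<close>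

text \<open>At \<open>{v}\<close> the exponent of x - 1 is 0, and the weight is the truncated
  difference of the h-polynomial of the figure; with the sum over larger faces through
  \<open>v\<close> it forms \<open>c_poly\<close>.\<close>

lemma dual_h_sweep:
  fixes P :: "'a::euclidean_space set"
  assumes P: "polytope P" and dim: "1 \<le> aff_dim P" and gen: "generic_sweep P p"
    and Q: "\<And>v. v \<in> vertices P \<Longrightarrow> vertex_figure P v (Q v)"
  shows "2 * dual_h P {} = (\<Sum>v\<in>vertices P.
    c_poly (nat (aff_dim P) - 1) (dual_h (Q v) {}) -
      [:-1, 1:] ^ 2 * dual_h (sweep_section p v (Q v)) {})"
proof -
  let ?f = "\<lambda>F. dual_g P F * [:-1, 1:] ^ nat (aff_dim F)"
  have "dual_h P {} = (\<Sum>F\<in>{F. F face_of P \<and> F \<noteq> {}}. ?f F)"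
    unfolding dual_h_def by (intro sum.cong) auto
  then have "2 * dual_h P {} = 2 * (\<Sum>F\<in>{F. F face_of P \<and> F \<noteq> {}}. ?f F)" by simp
  also have "\<dots> = (\<Sum>v\<in>vertices P. 2 * ?f {v} + (\<Sum>F\<in>{F. F face_of P \<and> v \<in> F \<and> F \<noteq> {v}}. ?f F) -
      (\<Sum>F\<in>{F. F face_of P \<and> v \<in> F \<and> F \<noteq> {v} \<and> F \<inter> sweep_section p v (Q v) \<noteq> {}}. ?f F))"
    by (rule sum_faces_by_sweep[OF P gen Q])
  also have "\<dots> = (\<Sum>v\<in>vertices P.
    c_poly (nat (aff_dim P) - 1) (dual_h (Q v) {}) -
      [:-1, 1:] ^ 2 * dual_h (sweep_section p v (Q v)) {})"
  proof (rule sum.cong[OF refl])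
    fix v assume v: "v \<in> vertices P"
    have vP: "P \<noteq> {v}" using dim by auto
    note vq = vertex_figure_dual[OF P v vP Q[OF v]]
    have "Q v \<noteq> {}" using vq(2) dim by auto
    then have "dual_g (Q v) {} = trunc_diff (nat (aff_dim P) - 1) (dual_h (Q v) {})"
      using dual_g_eq[OF vq(1) empty_face_of] vq(2) dim by (simp add: nat_diff_distrib)
    then have "?f {v} = trunc_diff (nat (aff_dim P) - 1) (dual_h (Q v) {})"
      using vq(3) by simp
    then show "2 * ?f {v} + (\<Sum>F\<in>{F. F face_of P \<and> v \<in> F \<and> F \<noteq> {v}}. ?f F) -
      (\<Sum>F\<in>{F. F face_of P \<and> v \<in> F \<and> F \<noteq> {v} \<and> F \<inter> sweep_section p v (Q v) \<noteq> {}}. ?f F) =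
      c_poly (nat (aff_dim P) - 1) (dual_h (Q v) {}) -
      [:-1, 1:] ^ 2 * dual_h (sweep_section p v (Q v)) {}"
      by (simp only: c_poly_def vq(4) sweep_section_dual(3)[OF P gen v vP Q[OF v]])
  qed
  finally show ?thesis .
qed

section \<open>Existence of sweep directions and vertex figures\<close>

text \<open>Non-generic directions lie in finitely many hyperplanes orthogonal to differences of
  vertices, a null set. Palindromicity speaks of \<open>P\<close> alone, so its proof must choose a
  direction.\<close>

lemma generic_sweep_exists:
  fixes P :: "'a::euclidean_space set"
  assumes "polytope P"
  obtains p where "generic_sweep P p"
proof -
  let ?V = "vertices P"
  let ?B = "\<lambda>(v, w). {p. (v - w) \<bullet> p = 0}"
  have "negligible (\<Union>(?B ` {(v, w) \<in> ?V \<times> ?V. v \<noteq> w}))"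
  proof (rule negligible_Union)
    have "finite (?V \<times> ?V)" using finite_vertices[OF assms] by simp
    then have "finite {(v, w) \<in> ?V \<times> ?V. v \<noteq> w}" by (rule rev_finite_subset) auto
    then show "finite (?B ` {(v, w) \<in> ?V \<times> ?V. v \<noteq> w})" by simp
    show "negligible T" if "T \<in> ?B ` {(v, w) \<in> ?V \<times> ?V. v \<noteq> w}" for T
      using that by (auto intro!: negligible_hyperplane)
  qed
  then have "(\<Union>(?B ` {(v, w) \<in> ?V \<times> ?V. v \<noteq> w})) \<noteq> UNIV"
    using non_negligible_UNIV by metis
  then obtain p where p: "p \<notin> (\<Union>(?B ` {(v, w) \<in> ?V \<times> ?V. v \<noteq> w}))" by blast
  have "generic_sweep P p"
    unfolding generic_sweep_def
  proof (rule inj_onI, rule ccontr)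
    fix v w assume vw: "v \<in> ?V" "w \<in> ?V" "p \<bullet> v = p \<bullet> w" "v \<noteq> w"
    then have "(v - w) \<bullet> p = 0" using inner_commute[of p v] inner_commute[of p w] by (simp only: inner_diff_left diff_self)
    then show False using p vw by blast
  qed
  then show ?thesis by (rule that)
qed

text \<open>A vertex is an exposed face; a level strictly between its value and those of the other
  vertices gives a cut of admissible depth.\<close>

lemma vertex_figure_exists:
  fixes P :: "'a::euclidean_space set"
  assumes P: "polytope P" and v: "v \<in> vertices P" "P \<noteq> {v}"
  obtains Q where "vertex_figure P v Q"
proof -
  have "{v} exposed_face_of P"
    using exposed_face_of_polyhedron[OF polytope_imp_polyhedron[OF P]] v(1) by (simp add: vertex_face)
  then obtain a b where ab: "P \<subseteq> {x. a \<bullet> x \<le> b}" "{v} = P \<inter> {x. a \<bullet> x = b}"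
    unfolding exposed_face_of_def by blast
  \<comment> \<open>A zero normal would expose all of \<open>P\<close> or nothing, and
    \<open>P\<close> is not \<open>{v}\<close>.\<close>
  have a0: "a \<noteq> 0"
  proof
    assume "a = 0"
    then have "P \<inter> {x. a \<bullet> x = b} = (if b = 0 then P else {})" by auto
    then show False using ab(2) v(2) by (auto split: if_splits)
  qed
  have less: "a \<bullet> w < b" if "w \<in> vertices P" "w \<noteq> v" for w
  proof -
    have "w \<in> P" using that vertices_subset by blast
    then have "a \<bullet> w \<le> b" "a \<bullet> w \<noteq> b" using ab that(2) by auto
    then show ?thesis by simp
  qed
  \<comment> \<open>Inserting \<open>b - 1\<close> keeps the maximum defined, and below
    \<open>b\<close>, even over an empty set of other vertices.\<close>
  define M where "M = Max (insert (b - 1) ((\<bullet>) a ` (vertices P - {v})))"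
  have fin: "finite (insert (b - 1) ((\<bullet>) a ` (vertices P - {v})))"
    using finite_vertices[OF P] by simp
  have Mb: "M < b" unfolding M_def using fin less by (subst Max_less_iff) auto
  have M: "a \<bullet> w \<le> M" if "w \<in> vertices P" "w \<noteq> v" for w
    unfolding M_def using fin that by (intro Max_ge) auto
  have "vertex_figure P v (P \<inter> {x. a \<bullet> x = (M + b) / 2})"
    unfolding vertex_figure_def
  proof (rule exI[of _ a], rule exI[of _ b], rule exI[of _ "(M + b) / 2"], intro conjI ballI impI)
    show "a \<bullet> x \<le> b" if "x \<in> P" for x using that ab(1) by blast
    show "a \<bullet> w < (M + b) / 2" if "w \<in> vertices P" "w \<noteq> v" for w
      using M[OF that] Mb by simp
  qed (use a0 ab(2) Mb in auto)
  then show ?thesis by (rule that)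
qed

lemma dual_h_singleton: "dual_h {v} {} = 1"
proof -
  have "{G. G face_of {v} \<and> {} \<subset> G} = {{v}}"
    using face_of_imp_subset by (fastforce simp: face_of_refl)
  then show ?thesis by (simp add: dual_h_def)
qed

text \<open>This value makes the second summand vanish by itself when the sweep section is
  empty.\<close>

lemma dual_h_empty: "dual_h {} {} = 0"
proof -
  have "{G. G face_of ({} :: 'a set) \<and> {} \<subset> G} = {}"
    using face_of_imp_subset by auto
  then show ?thesis unfolding dual_h_def by (simp only: sum.empty)
qed

lemma palindromic_0: "palindromic n 0"
  by (simp add: palindromic_def)

lemma palindromic_diff: "palindromic n q \<Longrightarrow> palindromic n r \<Longrightarrow> palindromic n (q - r)"
  by (simp add: palindromic_def)

lemma palindromic_sum: "(\<And>x. x \<in> A \<Longrightarrow> palindromic n (f x)) \<Longrightarrow> palindromic n (sum f A)"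
  by (auto simp: palindromic_def coeff_sum intro!: sum.cong sum.neutral)

lemma palindromic_double: "palindromic n (2 * q) \<Longrightarrow> palindromic n q"
  unfolding palindromic_def mult_2 coeff_add by auto

text \<open>Palindromicity (the Dehn-Sommerville equations) needs no Euler relation here: both summands
  of the sweep identity are palindromic by induction on the dimension.\<close>

lemma palindromic_dual_h:
  fixes P :: "'a::euclidean_space set"
  assumes "polytope P" "P \<noteq> {}"
  shows "palindromic (nat (aff_dim P)) (dual_h P {})"
  using assms
proof (induction "nat (aff_dim P)" arbitrary: P rule: less_induct)
  case less
  have "0 \<le> aff_dim P" using less.prems(2) by (meson aff_dim_negative_iff not_less)
  show ?case
  proof (cases "aff_dim P = 0")
    case True
    then obtain v where "P = {v}" using aff_dim_eq_0 by blast
    then show ?thesis by (simp add: dual_h_singleton palindromic_def)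
  next
    case False
    then have dim: "1 \<le> aff_dim P" using \<open>0 \<le> aff_dim P\<close> by linarith
    \<comment> \<open>Any direction and any figures serve, since the left-hand side of
      \<open>dual_h_sweep\<close> does not depend on them.\<close>
    obtain p where gen: "generic_sweep P p" using generic_sweep_exists less.prems(1) by blast
    have vP: "P \<noteq> {v}" for v using dim by auto
    have "\<forall>v\<in>vertices P. \<exists>Q. vertex_figure P v Q"
      using vertex_figure_exists[OF less.prems(1) _ vP] by metis
    then obtain Q where Q: "\<And>v. v \<in> vertices P \<Longrightarrow> vertex_figure P v (Q v)" by metis
    have "palindromic (nat (aff_dim P)) (c_poly (nat (aff_dim P) - 1) (dual_h (Q v) {}) -
        [:-1, 1:] ^ 2 * dual_h (sweep_section p v (Q v)) {})" if v: "v \<in> vertices P" for v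
    proof (rule palindromic_diff)
      note vq = vertex_figure_dual[OF less.prems(1) v vP Q[OF v]]
      note sr = sweep_section_dual[OF less.prems(1) gen v vP Q[OF v]]
      have "Q v \<noteq> {}" using vq(2) dim by auto
      then have "palindromic (nat (aff_dim (Q v))) (dual_h (Q v) {})"
        using vq(1,2) dim by (intro less.hyps) auto
      moreover have "nat (aff_dim (Q v)) = nat (aff_dim P) - 1" using vq(2) by simp
      ultimately have "palindromic (Suc (nat (aff_dim P) - 1)) (c_poly (nat (aff_dim P) - 1) (dual_h (Q v) {}))"
        by (intro palindromic_c_poly) simp
      then show "palindromic (nat (aff_dim P)) (c_poly (nat (aff_dim P) - 1) (dual_h (Q v) {}))"
        using dim by simp
      show "palindromic (nat (aff_dim P)) ([:-1, 1:] ^ 2 * dual_h (sweep_section p v (Q v)) {})"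
      proof (cases "sweep_section p v (Q v) = {}")
        case True
        then show ?thesis by (simp only: dual_h_empty mult_zero_right palindromic_0)
      next
        case False
        then have d: "aff_dim (sweep_section p v (Q v)) = aff_dim P - 2" by (rule sr(2))
        have "0 \<le> aff_dim (sweep_section p v (Q v))"
          using False by (meson aff_dim_negative_iff not_less)
        then have "nat (aff_dim P) = nat (aff_dim (sweep_section p v (Q v))) + 2" using d by simp
        moreover have "palindromic (nat (aff_dim (sweep_section p v (Q v))))
            (dual_h (sweep_section p v (Q v)) {})"
          using sr(1) False calculation by (intro less.hyps) auto
        ultimately show ?thesis using palindromic_linear_sq by metis
      qed
    qed
    moreover have "2 * dual_h P {} = (\<Sum>v\<in>vertices P.
        c_poly (nat (aff_dim P) - 1) (dual_h (Q v) {}) -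
          [:-1, 1:] ^ 2 * dual_h (sweep_section p v (Q v)) {})"
      by (rule dual_h_sweep[OF less.prems(1) dim gen Q])
    ultimately have "palindromic (nat (aff_dim P)) (2 * dual_h P {})"
      using palindromic_sum[of "vertices P"] by simp
    then show ?thesis by (rule palindromic_double)
  qed
qed

lemma dual_polytope_h_vector:
  fixes P Pd :: "'a::euclidean_space set"
  assumes "dual_polytope P Pd"
  shows "h_vector Pd = coeffs_from_top (nat (aff_dim P)) (dual_h P {})"
  using dual_polytope_toric_h[OF assms] by (simp add: h_vector_def)

theorem theorem6:
  fixes P Pd :: "'a::euclidean_space set" and Q Qd Rd :: "'a \<Rightarrow> 'a set"
    and p :: 'a and d :: nat
  assumes "polytope P" and "aff_dim P = int d"
    and "generic_sweep P p"
    and "\<And>v. v \<in> vertices P \<Longrightarrow> vertex_figure P v (Q v)"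
    and "dual_polytope P Pd"
    and "\<And>v. v \<in> vertices P \<Longrightarrow> dual_polytope (Q v) (Qd v)"
    and "\<And>v. v \<in> vertices P \<Longrightarrow> sweep_section p v (Q v) \<noteq> {} \<Longrightarrow>
           dual_polytope (sweep_section p v (Q v)) (Rd v)"
  shows "(d > 0 \<longrightarrow>
           h_vector Pd = map (\<lambda>i. \<Sum>v\<in>vertices P. 1 / 2 *
             (op_c (h_vector (Qd v)) ! i +
              (if sweep_section p v (Q v) = {} then 0
               else 2 * op_d (h_vector (Rd v)) ! i - op_c (op_c (h_vector (Rd v))) ! i)))
             [0..<Suc d]) \<and>
         (d = 0 \<longrightarrow> h_vector Pd = [1])"
proof (intro conjI impI)
  assume "d = 0"
  then have "aff_dim P = 0" using assms(2) by simp
  then obtain v where "P = {v}" using aff_dim_eq_0 by blast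
  then show "h_vector Pd = [1]"
    using dual_polytope_h_vector[OF assms(5)]
    by (simp add: dual_h_singleton coeffs_from_top_def)
next
  assume d: "d > 0"
  have dim: "1 \<le> aff_dim P" using d assms(2) by simp
  then have "P \<noteq> {}" by auto
  have vP: "P \<noteq> {v}" for v using dim by auto
  let ?h = "dual_h P {}" and ?q = "\<lambda>v. dual_h (Q v) {}"
    and ?r = "\<lambda>v. dual_h (sweep_section p v (Q v)) {}"
  have term_eq: "op_c (h_vector (Qd v)) ! i +
      (if sweep_section p v (Q v) = {} then 0
       else 2 * op_d (h_vector (Rd v)) ! i - op_c (op_c (h_vector (Rd v))) ! i) =
      coeff (c_poly (d - 1) (?q v) - [:-1, 1:] ^ 2 * ?r v) i"
    if v: "v \<in> vertices P" and i: "i \<le> d" for v i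
  proof -
    note vq = vertex_figure_dual[OF assms(1) v vP assms(4)[OF v]]
    note sr = sweep_section_dual[OF assms(1,3) v vP assms(4)[OF v]]
    have "Q v \<noteq> {}" using vq(2) dim by auto
    have dQ: "nat (aff_dim (Q v)) = d - 1" using vq(2) assms(2) by simp
    have pal: "palindromic (d - 1) (?q v)"
      using palindromic_dual_h[OF vq(1) \<open>Q v \<noteq> {}\<close>] dQ by simp
    have "h_vector (Qd v) = coeffs_from_top (d - 1) (?q v)"
      using dual_polytope_h_vector[OF assms(6)[OF v]] dQ by simp
    then have 1: "op_c (h_vector (Qd v)) ! i = coeff (c_poly (d - 1) (?q v)) i"
      using op_c_nth[of i "d - 1"] coeff_c_poly[OF pal, of i] i by simp
    have 2: "(if sweep_section p v (Q v) = {} then 0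
       else 2 * op_d (h_vector (Rd v)) ! i - op_c (op_c (h_vector (Rd v))) ! i) =
       - coeff ([:-1, 1:] ^ 2 * ?r v) i"
    proof (cases "sweep_section p v (Q v) = {}")
      case True
      then show ?thesis by (simp only: dual_h_empty mult_zero_right coeff_0 if_True minus_zero refl)
    next
      case False
      let ?n = "nat (aff_dim (sweep_section p v (Q v)))"
      have "0 \<le> aff_dim (sweep_section p v (Q v))"
        using False by (meson aff_dim_negative_iff not_less)
      \<comment> \<open>A nonempty section has dimension d - 2, so \<open>op_d\<close> and the
        double \<open>op_c\<close> give vectors of length d + 1 and every \<open>i\<close> is in
        range.\<close>
      then have "i \<le> ?n + 2" using sr(2)[OF False] assms(2) i by simp
      moreover have "h_vector (Rd v) = coeffs_from_top ?n (?r v)"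
        by (rule dual_polytope_h_vector[OF assms(7)[OF v False]])
      ultimately show ?thesis
        using op_2d_minus_cc[OF palindromic_dual_h[OF sr(1) False]] False by simp
    qed
    show ?thesis unfolding 1 2 by simp
  qed
  have coeff_h: "coeff ?h i = (\<Sum>v\<in>vertices P. 1 / 2 * coeff (c_poly (d - 1) (?q v) - [:-1, 1:] ^ 2 * ?r v) i)" for i
  proof -
    have "2 * ?h = (\<Sum>v\<in>vertices P. c_poly (nat (aff_dim P) - 1) (?q v) - [:-1, 1:] ^ 2 * ?r v)"
      by (rule dual_h_sweep[OF assms(1) dim assms(3,4)])
    then have "coeff (2 * ?h) i = (\<Sum>v\<in>vertices P. coeff (c_poly (d - 1) (?q v) - [:-1, 1:] ^ 2 * ?r v) i)"
      by (simp only: coeff_sum assms(2) nat_int)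
    moreover have "coeff (2 * ?h) i = 2 * coeff ?h i" by (simp only: mult_2 coeff_add)
    ultimately show ?thesis unfolding sum_distrib_left[symmetric] by simp
  qed
  \<comment> \<open>By palindromicity the coefficients listed from the top are also those listed in
    ascending order.\<close>
  have "h_vector Pd = map (coeff ?h) [0..<Suc d]"
    using dual_polytope_h_vector[OF assms(5)] palindromic_dual_h[OF assms(1) \<open>P \<noteq> {}\<close>] assms(2)
    by (simp only: nat_int coeffs_from_top_palindromic)
  also have "\<dots> = map (\<lambda>i. \<Sum>v\<in>vertices P. 1 / 2 *
             (op_c (h_vector (Qd v)) ! i +
              (if sweep_section p v (Q v) = {} then 0
               else 2 * op_d (h_vector (Rd v)) ! i - op_c (op_c (h_vector (Rd v))) ! i)))
             [0..<Suc d]"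
  proof (rule map_cong[OF refl])
    fix i assume "i \<in> set [0..<Suc d]"
    then have "i \<le> d" by (simp del: upt_Suc)
    then show "coeff ?h i = (\<Sum>v\<in>vertices P. 1 / 2 *
             (op_c (h_vector (Qd v)) ! i +
              (if sweep_section p v (Q v) = {} then 0
               else 2 * op_d (h_vector (Rd v)) ! i - op_c (op_c (h_vector (Rd v))) ! i)))"
      unfolding coeff_h by (intro sum.cong refl arg_cong[of _ _ "(*) (1 / 2)"] term_eq[symmetric])
  qed
  finally show "h_vector Pd = map (\<lambda>i. \<Sum>v\<in>vertices P. 1 / 2 *
             (op_c (h_vector (Qd v)) ! i +
              (if sweep_section p v (Q v) = {} then 0
               else 2 * op_d (h_vector (Rd v)) ! i - op_c (op_c (h_vector (Rd v))) ! i)))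
             [0..<Suc d]" .
qed

end
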